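(* For every bipartite graph $H$ with $\gamma(H) > 1$, every $H$-free graph $G$ has a minor $J$ with $$\mathrm{d}(J) \geq (\mathrm{d}(G))^{\frac{\gamma(H)}{2(\gamma(H)-1)}-o_{\mathrm{d}(G)}(1)}.$$
   Context: All graphs are finite and simple; $\mathrm{d}(G)=|E(G)|/|V(G)|$ is the density. $G$ is $H$-free if no subgraph of $G$ is isomorphic to $H$. The Turán number $\operatorname{ex}(n,H)$ is the maximum number of edges in an $H$-free graph on $n$ vertices, and the Turán exponent is $\gamma(H)=\limsup_{n\to\infty}\frac{\log \operatorname{ex}(n,H)}{\log n}$. The term $o_{\mathrm{d}(G)}(1)$ tends to $0$ as $\mathrm{d}(G)\to\infty$ (with $H$ fixed). *)

theory Defs
  imports Complex_Main "HOL-Library.Extended_Real" "HOL-Library.Liminf_Limsup"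
    "HOL-Library.Disjoint_Sets"
begin

record 'a ugraph =
  verts :: "'a set"
  edges :: "'a set set"

definition simple_graph :: "'a ugraph \<Rightarrow> bool" where
  "simple_graph G \<longleftrightarrow>
     finite (verts G) \<and>
     edges G \<subseteq> {{u, v} | u v. u \<in> verts G \<and> v \<in> verts G \<and> u \<noteq> v}"

definition graph_density :: "'a ugraph \<Rightarrow> real" where
  "graph_density G = real (card (edges G)) / real (card (verts G))"

definition bipartite :: "'a ugraph \<Rightarrow> bool" where
  "bipartite G \<longleftrightarrow>
     (\<exists>A B. A \<union> B = verts G \<and> A \<inter> B = {} \<and>
        edges G \<subseteq> {{a, b} | a b. a \<in> A \<and> b \<in> B})"

definition subgraph :: "'a ugraph \<Rightarrow> 'a ugraph \<Rightarrow> bool" where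
  "subgraph K G \<longleftrightarrow> simple_graph K \<and> verts K \<subseteq> verts G \<and> edges K \<subseteq> edges G"

definition isomorphic :: "'a ugraph \<Rightarrow> 'b ugraph \<Rightarrow> bool" where
  "isomorphic G H \<longleftrightarrow>
     (\<exists>\<phi>. bij_betw \<phi> (verts G) (verts H) \<and>
        (\<forall>u \<in> verts G. \<forall>v \<in> verts G. {u, v} \<in> edges G \<longleftrightarrow> {\<phi> u, \<phi> v} \<in> edges H))"

definition graph_free :: "'a ugraph \<Rightarrow> 'b ugraph \<Rightarrow> bool" where
  "graph_free H G \<longleftrightarrow> \<not> (\<exists>K. subgraph K G \<and> isomorphic K H)"

text \<open>The set below is a finite set of natural numbers, so its supremum is its maximum; it is
  \<open>0\<close> in the degenerate case that no \<open>H\<close>-free graph on \<open>n\<close> vertices exists. Every finite graph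
  is isomorphic to one whose vertices are natural numbers.\<close>

definition turan_number :: "nat \<Rightarrow> 'a ugraph \<Rightarrow> nat" where
  "turan_number n H =
     Sup {card (edges G) | G :: nat ugraph.
            simple_graph G \<and> card (verts G) = n \<and> graph_free H G}"

text \<open>For \<open>n \<ge> 2\<close> the quotient lies between \<open>0\<close> and \<open>2\<close> (as \<open>ln 0 = 0\<close>), hence the limit
  superior is finite and \<open>real_of_ereal\<close> loses nothing.\<close>

definition turan_exponent :: "'a ugraph \<Rightarrow> real" where
  "turan_exponent H =
     real_of_ereal
       (limsup (\<lambda>n. ereal (ln (real (turan_number n H)) / ln (real n))))"

definition connected_in :: "'a ugraph \<Rightarrow> 'a set \<Rightarrow> bool" where
  "connected_in G S \<longleftrightarrow>
     S \<noteq> {} \<and> S \<subseteq> verts G \<and>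
     (\<forall>u \<in> S. \<forall>v \<in> S. (u, v) \<in> {(x, y). x \<in> S \<and> y \<in> S \<and> {x, y} \<in> edges G}\<^sup>*)"

text \<open>\<open>B x\<close> is the branch set that is contracted to the vertex \<open>x\<close> of the minor.\<close>

definition is_minor :: "'a ugraph \<Rightarrow> 'b ugraph \<Rightarrow> bool" where
  "is_minor J G \<longleftrightarrow>
     (\<exists>B. (\<forall>x \<in> verts J. connected_in G (B x)) \<and>
        disjoint_family_on B (verts J) \<and>
        (\<forall>x y. {x, y} \<in> edges J \<longrightarrow> (\<exists>u \<in> B x. \<exists>v \<in> B y. {u, v} \<in> edges G)))"

end

theory Submission
  imports Defs
begin

text \<open>
  Let \<open>d\<close> be the density of \<open>G\<close>. Being \<open>H\<close>-free, \<open>G\<close> has no subgraph of density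
  \<open>d\<^bsup>1-o(1)\<^esup>\<close> on fewer than \<open>N = d\<^bsup>1/(\<gamma>-1)-o(1)\<^esup>\<close> vertices. Contract \<open>G\<close> in rounds. When the
  branch sets have size at most \<open>M\<close>, every set of at most \<open>N/M\<close> vertices of the contracted graph spans
  density at most \<open>M\<close> times the original local bound, since it can be pulled back to \<open>G\<close>. This local
  sparseness makes neighbourhoods of most pairs of vertices nearly disjoint, so stars can be chosen
  whose contraction creates few parallel edges: a round multiplies the branch set size by some
  \<open>g \<ge> 2\<close> and the density by at least \<open>g\<^bsup>1-\<epsilon>\<^esup>\<close>. The rounds continue until \<open>M\<close> is about \<open>(N/d)\<^bsup>1/2\<^esup>\<close>,
  when the density is \<open>(N d)\<^bsup>1/2-o(1)\<^esup> = d\<^bsup>\<gamma>/(2(\<gamma>-1))-o(1)\<^esup>\<close>.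

  In a round there are two cases. If vertices of huge degree carry many edges, they serve as centres,
  and the far more numerous remaining vertices are distributed over them as evenly as possible.
  Otherwise the graph is almost regular, and a first contraction of a maximal family of disjoint stars
  produces a similarly unbalanced situation.
\<close>

text \<open>The barrier M = (N/d)^(1/2) comes from counting shared neighbours: a whole neighbourhood
  of the contracted graph, pulled back to G, must have at most N vertices. With branch sets of size
  M and degrees about d M this asks for d M^2 \<le> N.

  Every round loses a constant factor, harmless only below a small power of the growth of the branch
  sets. For huge degrees the factor is absolute, and a large \<open>K1\<close> pays for it. For
  almost regular graphs it is a power of the degree ratio \<open>\<Gamma>\<close>, which grows with
  \<open>K1\<close>; hence a second parameter \<open>K2\<close>, chosen after
  \<open>\<Gamma>\<close>.

  Contracting stars raises degrees, but the new edges might be spread over far more centres than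
  received leaves. Balancing rules this out: when the sum of squared loads is least, a centre to
  which a leaf could move is at most one leaf behind its present centre, and some level is at least
  half as large as the level below it.

  Fitting neighbourhoods into N needs an upper bound on densities. Arguing by contradiction provides
  it: if no quotient of G reaches the target density, no subset of an intermediate graph
  does.\<close>

section \<open>Small overlaps, load levels and greedy choices\<close>

text \<open>Each further set adds at least \<open>a - card Z * \<eta>\<close> to the union of the
  earlier ones. Subtracting \<open>\<eta>\<close> for all ordered pairs is cruder than
  inclusion-exclusion needs, but leaves a single product for the induction.\<close>

lemma card_UN_ge:
  fixes a \<eta> :: real
  assumes "finite Z" "0 \<le> \<eta>"
    and "\<And>x. x \<in> Z \<Longrightarrow> finite (A x)"
    and "\<And>x. x \<in> Z \<Longrightarrow> a \<le> card (A x)"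
    and "\<And>x y. \<lbrakk>x \<in> Z; y \<in> Z; x \<noteq> y\<rbrakk> \<Longrightarrow> card (A x \<inter> A y) \<le> \<eta>"
  shows "card Z * (a - card Z * \<eta>) \<le> card (\<Union>x\<in>Z. A x)"
  using assms
proof (induction Z rule: finite_induct)
  case (insert z Z)
  let ?U = "\<Union>x\<in>Z. A x"
  have IH: "card Z * (a - card Z * \<eta>) \<le> card ?U"
    using insert by auto
  have fin: "finite ?U" "finite (A z)" using insert by auto
  have "A z \<inter> ?U = (\<Union>x\<in>Z. A z \<inter> A x)" by auto
  then have "card (A z \<inter> ?U) \<le> (\<Sum>x\<in>Z. card (A z \<inter> A x))"
    using card_UN_le[OF insert.hyps(1), of "\<lambda>x. A z \<inter> A x"] by simp
  then have "real (card (A z \<inter> ?U)) \<le> (\<Sum>x\<in>Z. real (card (A z \<inter> A x)))"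
    by (metis of_nat_mono of_nat_sum)
  also have "\<dots> \<le> (\<Sum>x\<in>Z. \<eta>)"
    using insert.hyps(2) by (intro sum_mono insert.prems(4)) auto
  finally have i: "card (A z \<inter> ?U) \<le> card Z * \<eta>" by simp
  have u: "real (card (A z)) + card ?U = card (A z \<union> ?U) + card (A z \<inter> ?U)"
    using card_Un_Int[OF fin(2,1)] by (metis of_nat_add)
  have "a \<le> card (A z)" using insert by auto
  have e: "card (insert z Z) * (a - card (insert z Z) * \<eta>)
      = card Z * (a - card Z * \<eta>) + a - 2 * (card Z * \<eta>) - \<eta>"
    using insert.hyps by (simp add: algebra_simps)
  have nn: "0 \<le> card Z * \<eta>" using insert.prems by simp
  have "card Z * (a - card Z * \<eta>) + a - 2 * (card Z * \<eta>) - \<eta> \<le> card (A z \<union> ?U)"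
    using IH i u \<open>a \<le> card (A z)\<close> insert.prems(1) nn by linarith
  with e show ?case by simp
qed simp

text \<open>If every level above \<open>K\<close> had at most half the size of the level below it,
  the loads in excess of \<open>K\<close> would sum like a geometric series to at most
  \<open>card Y\<close>, so the total would not exceed \<open>(K + 1) * card Y\<close>.\<close>

lemma ex_popular_level:
  fixes load :: "'y \<Rightarrow> nat"
  assumes "finite Y" and "(K + 1) * card Y < (\<Sum>y\<in>Y. load y)"
  shows "\<exists>t>K. {y\<in>Y. t \<le> load y} \<noteq> {} \<and>
    card {y\<in>Y. t - 1 \<le> load y} \<le> 2 * card {y\<in>Y. t \<le> load y}"
proof (rule ccontr)
  assume neg: "\<not> ?thesis"
  define a where "a t = card {y\<in>Y. t \<le> load y}" for t
  have half: "2 * a t \<le> a (t - 1)" if "t > K" for t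
  proof (cases "{y\<in>Y. t \<le> load y} = {}")
    case True
    then show ?thesis unfolding a_def by (simp only: card.empty)
  next
    case False
    with neg that have "\<not> a (t - 1) \<le> 2 * a t" unfolding a_def by blast
    then show ?thesis by simp
  qed
  define m where "m = K + (\<Sum>y\<in>Y. load y)"
  have lm: "load y \<le> m" if "y \<in> Y" for y
    unfolding m_def using member_le_sum[OF that, of load] assms(1) by simp
  have cnt: "load y - K = (\<Sum>t\<in>{K<..m}. of_bool (t \<le> load y))" if "y \<in> Y" for y
  proof -
    have "{t \<in> {K<..m}. t \<le> load y} = {K<..load y}"
      using lm[OF that] by auto
    then have "card {t \<in> {K<..m}. t \<le> load y} = load y - K" by simp
    moreover have "{t \<in> {K<..m}. t \<le> load y} = {K<..m} \<inter> {t. t \<le> load y}" by auto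
    ultimately show ?thesis by (simp add: sum_of_bool_eq)
  qed
  have "(\<Sum>y\<in>Y. load y - K) = (\<Sum>y\<in>Y. \<Sum>t\<in>{K<..m}. of_bool (t \<le> load y))"
    using cnt by (intro sum.cong) auto
  also have "\<dots> = (\<Sum>t\<in>{K<..m}. \<Sum>y\<in>Y. of_bool (t \<le> load y))"
    by (rule sum.swap)
  also have "\<dots> = (\<Sum>t\<in>{K<..m}. a t)"
    unfolding a_def using assms(1)
    by (intro sum.cong) (auto simp: sum_of_bool_eq Int_def)
  finally have S: "(\<Sum>y\<in>Y. load y - K) = (\<Sum>t\<in>{K<..m}. a t)" .
  \<comment> \<open>The extra \<open>a n\<close> drives the induction: two copies of the next level
    fit into it.\<close>
  have geo: "(\<Sum>t\<in>{K<..n}. a t) + a n \<le> a K" if "n \<ge> K" for n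
    using that
  proof (induction n rule: dec_induct)
    case (step n)
    have "{K<..Suc n} = insert (Suc n) {K<..n}" using step by auto
    then show ?case using step half[of "Suc n"] by simp
  qed simp
  have "(\<Sum>y\<in>Y. load y) \<le> (\<Sum>y\<in>Y. (load y - K) + K)"
    by (intro sum_mono) simp
  also have "\<dots> = (\<Sum>t\<in>{K<..m}. a t) + K * card Y"
    by (simp only: sum.distrib S) simp
  also have "\<dots> \<le> a K + K * card Y"
    using geo[of m] by (simp add: m_def)
  also have "a K \<le> card Y"
    unfolding a_def using assms(1) by (intro card_mono) auto
  finally show False using assms(2) by simp
qed

text \<open>Greedy list colouring: the lists are the \<open>F\<close>-images, the conflict graph is
  \<open>R\<close>, and every list is longer than the degree of its vertex.\<close>

lemma ex_proper_assignment:
  fixes F :: "('x \<times> 'y) set"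
  assumes "finite X" "\<And>x. x \<in> X \<Longrightarrow> finite (F `` {x})" "symp R"
    and "\<And>x. x \<in> X \<Longrightarrow> card {x' \<in> X. x' \<noteq> x \<and> R x x'} < card (F `` {x})"
  shows "\<exists>f. (\<forall>x\<in>X. (x, f x) \<in> F) \<and> (\<forall>x\<in>X. \<forall>x'\<in>X. x' \<noteq> x \<and> R x x' \<longrightarrow> f x \<noteq> f x')"
  using assms
proof (induction X rule: finite_induct)
  case (insert z X)
  have fewer: "card {x' \<in> X. x' \<noteq> x \<and> R x x'} < card (F `` {x})" if "x \<in> X" for x
  proof -
    have "card {x' \<in> X. x' \<noteq> x \<and> R x x'} \<le> card {x' \<in> insert z X. x' \<noteq> x \<and> R x x'}"
      using insert.hyps by (intro card_mono) auto
    then show ?thesis using insert.prems(3)[of x] that by force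
  qed
  have "\<exists>f. (\<forall>x\<in>X. (x, f x) \<in> F) \<and>
      (\<forall>x\<in>X. \<forall>x'\<in>X. x' \<noteq> x \<and> R x x' \<longrightarrow> f x \<noteq> f x')"
    by (rule insert.IH[OF _ insert.prems(2) fewer]) (simp_all add: insert.prems(1))
  then obtain f where f: "\<forall>x\<in>X. (x, f x) \<in> F"
    "\<forall>x\<in>X. \<forall>x'\<in>X. x' \<noteq> x \<and> R x x' \<longrightarrow> f x \<noteq> f x'"
    by (elim exE conjE)
  let ?M = "{x' \<in> insert z X. x' \<noteq> z \<and> R z x'}"
  have "card (f ` ?M) \<le> card ?M" using insert.hyps by (intro card_image_le) auto
  also have "\<dots> < card (F `` {z})" using insert.prems(3) by simp
  finally have "\<not> F `` {z} \<subseteq> f ` ?M"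
    using card_mono[of "f ` ?M" "F `` {z}"] insert.hyps(1) by (auto simp: not_le[symmetric])
  then obtain y where y: "(z, y) \<in> F" "y \<notin> f ` ?M" by auto
  have sym: "R x z \<Longrightarrow> R z x" for x using insert.prems(2) by (auto dest: sympD)
  show ?case
  proof (intro exI[of _ "f(z := y)"] conjI ballI impI)
    fix x assume "x \<in> insert z X"
    then show "(x, (f(z := y)) x) \<in> F" using f y by auto
  next
    fix x x' assume xx: "x \<in> insert z X" "x' \<in> insert z X" "x' \<noteq> x \<and> R x x'"
    then have "f x \<noteq> f x'" if "x \<noteq> z" "x' \<noteq> z" using f(2) that by blast
    moreover have "y \<noteq> f x'" if "x = z" using y(2) xx that by blast
    moreover have "y \<noteq> f x" if "x' = z" using y(2) xx that sym by blast
    ultimately show "(f(z := y)) x \<noteq> (f(z := y)) x'" using xx by (auto split: if_splits)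
  qed
qed simp

text \<open>Greedy choice: each chosen element discards itself and at most \<open>m\<close>
  others.\<close>

lemma ex_independent_subset:
  assumes "finite A" "symp R" and "\<And>a. a \<in> A \<Longrightarrow> card {b \<in> A. b \<noteq> a \<and> R a b} \<le> m"
    and "L * (m + 1) \<le> card A"
  shows "\<exists>Z\<subseteq>A. card Z = L \<and> (\<forall>x\<in>Z. \<forall>y\<in>Z. x \<noteq> y \<longrightarrow> \<not> R x y)"
  using assms
proof (induction L arbitrary: A)
  case 0
  then show ?case by (intro exI[of _ "{}"]) auto
next
  case (Suc L)
  then have "A \<noteq> {}" by auto
  then obtain a where a: "a \<in> A" by auto
  let ?N = "insert a {b \<in> A. b \<noteq> a \<and> R a b}"
  have N: "?N \<subseteq> A" "card ?N \<le> m + 1"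
    using Suc.prems(1) Suc.prems(3)[OF a] a by auto
  have "card (A - ?N) = card A - card ?N"
    using N Suc.prems(1) by (meson card_Diff_subset finite_subset)
  then have c: "L * (m + 1) \<le> card (A - ?N)" using Suc.prems(4) N by simp
  have "card {b \<in> A - ?N. b \<noteq> x \<and> R x b} \<le> m" if "x \<in> A - ?N" for x
  proof -
    have "card {b \<in> A - ?N. b \<noteq> x \<and> R x b} \<le> card {b \<in> A. b \<noteq> x \<and> R x b}"
      using Suc.prems(1) by (intro card_mono) auto
    then show ?thesis using Suc.prems(3)[of x] that by force
  qed
  then obtain Z where Z: "Z \<subseteq> A - ?N" "card Z = L" "\<forall>x\<in>Z. \<forall>y\<in>Z. x \<noteq> y \<longrightarrow> \<not> R x y"
    using Suc.IH[of "A - ?N"] Suc.prems(1,2) c by auto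
  have "finite Z" using Z(1) Suc.prems(1) by (meson finite_Diff finite_subset)
  then show ?case
    using Z a Suc.prems(2)
    by (intro exI[of _ "insert a Z"]) (auto simp: card_insert_if dest: sympD)
qed

text \<open>\<open>R\<close> stands for pairs that overlap too much to share a star. Among the
  proper assignments one with least sum of squared loads is taken, and \<open>T\<close> is a popular
  level of it. Since a leaf of \<open>T\<close> cannot gain by moving, all but \<open>\<mu>\<close>
  of its possible centres have load at most one less, so they lie in \<open>Y0\<close>, the level
  below, which is at most twice as large as \<open>T\<close>.\<close>

lemma ex_balanced_assignment:
  fixes F :: "('x \<times> 'y) set" and d \<mu> :: real
  assumes X: "finite X" and Y: "finite Y" and F: "F \<subseteq> X \<times> Y" and R: "symp R"
    and few0: "\<forall>x\<in>X. card {x' \<in> X. x' \<noteq> x \<and> R x x'} \<le> \<mu>"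
    and deg0: "\<forall>x\<in>X. d \<le> card (F `` {x})" and "\<mu> < d"
    and many: "(K + 1) * card Y < card X"
  shows "\<exists>f T Y0. T \<noteq> {} \<and> T \<subseteq> Y0 \<and> Y0 \<subseteq> Y \<and> card Y0 \<le> 2 * card T \<and>
    (\<forall>x\<in>X. (x, f x) \<in> F) \<and> (\<forall>x\<in>X. \<forall>x'\<in>X. x' \<noteq> x \<and> R x x' \<longrightarrow> f x \<noteq> f x') \<and>
    (\<forall>y\<in>T. K \<le> card {x\<in>X. f x = y}) \<and>
    (\<forall>x\<in>X. f x \<in> T \<longrightarrow> d - \<mu> \<le> card (F `` {x} \<inter> Y0))"
proof -
  note few = bspec[OF few0] and deg = bspec[OF deg0]
  define ok where "ok (f :: 'x \<Rightarrow> 'y) \<longleftrightarrow> (\<forall>x\<in>X. (x, f x) \<in> F) \<and>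
    (\<forall>x\<in>X. \<forall>x'\<in>X. x' \<noteq> x \<and> R x x' \<longrightarrow> f x \<noteq> f x')" for f
  define load where "load (f :: 'x \<Rightarrow> 'y) y = card {x\<in>X. f x = y}" for f y
  define pot where "pot (f :: 'x \<Rightarrow> 'y) = (\<Sum>y\<in>Y. (load f y)\<^sup>2)" for f
  have finF: "finite (F `` {x})" for x
    by (rule finite_subset[OF _ Y]) (use F in auto)
  have "\<exists>f. ok f"
    unfolding ok_def
  proof (rule ex_proper_assignment[OF X finF R])
    fix x assume "x \<in> X"
    then have "real (card {x' \<in> X. x' \<noteq> x \<and> R x x'}) < real (card (F `` {x}))"
      using few[of x] deg[of x] \<open>\<mu> < d\<close> by linarith
    then show "card {x' \<in> X. x' \<noteq> x \<and> R x x'} < card (F `` {x})" by simp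
  qed
  then obtain f where f: "ok f" and least: "\<And>g. ok g \<Longrightarrow> pot f \<le> pot g"
    using ex_has_least_nat[of ok _ pot] by auto
  have fY: "f x \<in> Y" if "x \<in> X" for x using f F that unfolding ok_def by auto
  \<comment> \<open>Moving \<open>x\<close> to a neighbour that holds no element related to \<open>x\<close> cannot decrease the sum of squares.\<close>
  have move: "load f (f x) \<le> load f z + 1"
    if x: "x \<in> X" and z: "(x, z) \<in> F" and nz: "z \<notin> f ` {x' \<in> X. x' \<noteq> x \<and> R x x'}" for x z
  proof (cases "z = f x")
    case False
    let ?g = "f(x := z)"
    have symR: "R x' x \<Longrightarrow> R x x'" for x' using R by (auto dest: sympD)
    have "ok ?g"
      unfolding ok_def
    proof (intro conjI ballI impI)
      fix u assume "u \<in> X"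
      then show "(u, ?g u) \<in> F" using f z unfolding ok_def by simp
    next
      fix u u' assume u: "u \<in> X" "u' \<in> X" "u' \<noteq> u \<and> R u u'"
      then have "f u \<noteq> f u'" using f unfolding ok_def by blast
      moreover have "z \<noteq> f u'" if "u = x" using nz u that by blast
      moreover have "z \<noteq> f u" if "u' = x" using nz u that symR by blast
      ultimately show "?g u \<noteq> ?g u'" using u by (auto split: if_splits)
    qed
    then have le: "pot f \<le> pot ?g" by (rule least)
    have zY: "z \<in> Y" using z F by auto
    have "{x'\<in>X. f x' = f x} = insert x {x'\<in>X. ?g x' = f x}"
      using x False by auto
    then have l1: "load f (f x) = load ?g (f x) + 1"
      unfolding load_def using X False by (simp add: card_insert_if)
    have "{x'\<in>X. ?g x' = z} = insert x {x'\<in>X. f x' = z}"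
      using x False by auto
    then have l2: "load ?g z = load f z + 1"
      unfolding load_def using X False by (simp add: card_insert_if)
    have l3: "load ?g y = load f y" if "y \<noteq> z" "y \<noteq> f x" for y
    proof -
      have "{x'\<in>X. ?g x' = y} = {x'\<in>X. f x' = y}" using that by auto
      then show ?thesis unfolding load_def by simp
    qed
    have split: "pot h = (load h (f x))\<^sup>2 + ((load h z)\<^sup>2 + (\<Sum>y\<in>Y - {f x} - {z}. (load h y)\<^sup>2))" for h
      unfolding pot_def using Y zY fY[OF x] False
      by (subst sum.remove[of Y "f x"]; simp?) (subst sum.remove[of "Y - {f x}" z]; simp)
    have "(\<Sum>y\<in>Y - {f x} - {z}. (load ?g y)\<^sup>2) = (\<Sum>y\<in>Y - {f x} - {z}. (load f y)\<^sup>2)"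
      by (intro sum.cong) (auto simp: l3 simp del: fun_upd_apply)
    with le split[of f] split[of ?g]
    have "(load f (f x))\<^sup>2 + (load f z)\<^sup>2 \<le> (load ?g (f x))\<^sup>2 + (load ?g z)\<^sup>2" by linarith
    then show ?thesis unfolding l1 l2 by (simp add: power2_eq_square)
  qed simp
  have "(\<Sum>y\<in>Y. load f y) = card (\<Union>y\<in>Y. {x\<in>X. f x = y})"
    unfolding load_def using X Y by (intro card_UN_disjoint[symmetric]) auto
  also have "(\<Union>y\<in>Y. {x\<in>X. f x = y}) = X" using fY by auto
  finally have "(K + 1) * card Y < (\<Sum>y\<in>Y. load f y)" using many by simp
  from ex_popular_level[OF Y this] obtain t where t: "t > K" "{y\<in>Y. t \<le> load f y} \<noteq> {}"
    "card {y\<in>Y. t - 1 \<le> load f y} \<le> 2 * card {y\<in>Y. t \<le> load f y}" by auto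
  have near: "d - \<mu> \<le> card (F `` {x} \<inter> {y\<in>Y. t - 1 \<le> load f y})"
    if x: "x \<in> X" "t \<le> load f (f x)" for x
  proof -
    let ?M = "{x' \<in> X. x' \<noteq> x \<and> R x x'}"
    let ?A = "F `` {x} \<inter> {y\<in>Y. t - 1 \<le> load f y}"
    \<comment> \<open>A possible centre of \<open>x\<close> is either blocked by a conflicting
      element, which accounts for at most \<open>\<mu>\<close> of them, or subject to
      \<open>move\<close> and hence of load at least \<open>t - 1\<close>.\<close>
    have "F `` {x} \<subseteq> ?A \<union> f ` ?M"
    proof
      fix z assume z: "z \<in> F `` {x}"
      show "z \<in> ?A \<union> f ` ?M"
      proof (cases "z \<in> f ` ?M")
        case False
        then have "load f (f x) \<le> load f z + 1" using move[OF x(1)] z by simp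
        then have "t - 1 \<le> load f z" using x(2) by simp
        then show ?thesis using z F by auto
      qed simp
    qed
    then have "card (F `` {x}) \<le> card (?A \<union> f ` ?M)"
      using X finF by (intro card_mono) auto
    also have "\<dots> \<le> card ?A + card (f ` ?M)" by (rule card_Un_le)
    also have "\<dots> \<le> card ?A + card ?M" using X by (simp add: card_image_le)
    finally show ?thesis using few[OF x(1)] deg[OF x(1)] by linarith
  qed
  let ?T = "{y\<in>Y. t \<le> load f y}" and ?Y0 = "{y\<in>Y. t - 1 \<le> load f y}"
  have "\<forall>y\<in>?T. K \<le> card {x\<in>X. f x = y}"
    using t(1) by (auto simp: load_def)
  moreover have "\<forall>x\<in>X. f x \<in> ?T \<longrightarrow> d - \<mu> \<le> card (F `` {x} \<inter> ?Y0)"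
    using near by blast
  moreover have "?T \<subseteq> ?Y0" "?Y0 \<subseteq> Y" by auto
  moreover note t(2,3) f[unfolded ok_def, THEN conjunct1] f[unfolded ok_def, THEN conjunct2]
  ultimately show ?thesis
    by - (rule exI[of _ f], rule exI[of _ ?T], rule exI[of _ ?Y0], intro conjI; assumption)
qed

section \<open>Local sparseness and shared neighbourhoods\<close>

text \<open>For a symmetric relation every edge counts as two ordered pairs, so
  \<open>\<delta>\<close> bounds the average degree of small vertex sets, twice their density.
  \<open>N\<close> is real because it gets divided by branch set sizes.\<close>

definition sparse_upto :: "('v \<times> 'v) set \<Rightarrow> real \<Rightarrow> real \<Rightarrow> bool" where
  "sparse_upto E N \<delta> \<longleftrightarrow>
     (\<forall>S. finite S \<and> real (card S) \<le> N \<longrightarrow> real (card (E \<inter> S \<times> S)) \<le> \<delta> * real (card S))"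

lemma sparse_upto_subset:
  fixes E :: "('v \<times> 'v) set"
  assumes "sparse_upto E N \<delta>" "E' \<subseteq> E" "finite E"
  shows "sparse_upto E' N \<delta>"
  unfolding sparse_upto_def
proof (intro allI impI)
  fix S :: "'v set" assume S: "finite S \<and> card S \<le> N"
  have "card (E' \<inter> S \<times> S) \<le> card (E \<inter> S \<times> S)"
    using assms by (intro card_mono) auto
  moreover have "card (E \<inter> S \<times> S) \<le> \<delta> * card S"
    using assms(1) S unfolding sparse_upto_def by blast
  ultimately show "card (E' \<inter> S \<times> S) \<le> \<delta> * card S" by linarith
qed

text \<open>Disjointness of the clusters makes the choice of one witnessing edge per pair injective.
  This converts adjacency between vertices and clusters into edges of \<open>E\<close>, to which
  sparseness applies.\<close>

lemma card_le_cluster_edges: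
  assumes "finite E" "disjoint_family_on C Y" "A \<subseteq> W \<times> Y"
    and "\<And>x y. (x, y) \<in> A \<Longrightarrow> \<exists>c\<in>C y. (x, c) \<in> E \<inter> W \<times> V"
  shows "card A \<le> card (E \<inter> W \<times> V)"
proof -
  obtain h where h: "\<And>x y. (x, y) \<in> A \<Longrightarrow> h x y \<in> C y \<and> (x, h x y) \<in> E \<inter> W \<times> V"
    using assms(4) by metis
  have "inj_on (\<lambda>(x, y). (x, h x y)) A"
  proof (rule inj_onI)
    fix p q assume pq: "p \<in> A" "q \<in> A" "(\<lambda>(x, y). (x, h x y)) p = (\<lambda>(x, y). (x, h x y)) q"
    obtain x y y' where e: "p = (x, y)" "q = (x, y')" "h x y = h x y'"
      using pq(3) by (cases p; cases q) auto
    have "h x y \<in> C y \<inter> C y'" using h[of x y] h[of x y'] pq e by simp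
    then show "p = q" using assms(2,3) pq e unfolding disjoint_family_on_def by blast
  qed
  moreover have "(\<lambda>(x, y). (x, h x y)) ` A \<subseteq> E \<inter> W \<times> V" using h by auto
  ultimately show ?thesis using assms(1) by (intro card_inj_on_le) auto
qed

text \<open>Many vertices sharing a fixed positive proportion of the neighbourhood of \<open>x\<close> would span,
  together with that neighbourhood, a small set that is too dense.\<close>

lemma few_mates:
  fixes \<delta> \<eta> N D1 :: real and L :: nat
  assumes E: "finite E" "sparse_upto E N \<delta>" and X: "finite X" and Y: "finite Y"
    and C: "disjoint_family_on C Y" "\<And>y. y \<in> Y \<Longrightarrow> finite (C y) \<and> card (C y) \<le> L"
    and F: "F = {(x, y). x \<in> X \<and> y \<in> Y \<and> (\<exists>c\<in>C y. (x, c) \<in> E)}"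
    and deg: "card (F `` {x}) \<le> D1"
    and par: "0 < \<delta>" "2 * \<delta> \<le> \<eta>" "1 \<le> D1 * L" "3 * (D1 * L) \<le> N"
  shows "card {x' \<in> X. x' \<noteq> x \<and> \<eta> < card (F `` {x} \<inter> F `` {x'})} \<le> 2 * \<delta> * (D1 * L) / \<eta>"
proof (rule ccontr)
  define m where "m = 2 * \<delta> * (D1 * L) / \<eta>"
  let ?T = "{x' \<in> X. x' \<noteq> x \<and> \<eta> < card (F `` {x} \<inter> F `` {x'})}"
  assume "\<not> card ?T \<le> 2 * \<delta> * (D1 * L) / \<eta>"
  then have mT: "m < card ?T" unfolding m_def by simp
  have \<eta>: "0 < \<eta>" using par by linarith
  have "0 \<le> m" unfolding m_def using par \<eta> by simp
  \<comment> \<open>Only just too many mates are kept: \<open>k \<le> m + 1\<close> is at most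
    \<open>2 * (D1 * L)\<close>, so together with the pulled back neighbourhood \<open>U\<close>
    they still number at most \<open>3 * (D1 * L) \<le> N\<close>.\<close>
  define k where "k = nat \<lfloor>m\<rfloor> + 1"
  have k: "m < k" "k \<le> m + 1" unfolding k_def using \<open>0 \<le> m\<close> by linarith+
  have "k \<le> card ?T" unfolding k_def using mT \<open>0 \<le> m\<close> by linarith
  then obtain T where T: "T \<subseteq> ?T" "card T = k" by (meson obtain_subset_with_card_n)
  have finT: "finite T" using T X by (auto intro: finite_subset)
  have "m \<le> D1 * L"
  proof -
    have "2 * \<delta> * (D1 * L) \<le> \<eta> * (D1 * L)" using par by (intro mult_right_mono) auto
    then show ?thesis unfolding m_def using \<eta> by (simp add: divide_le_eq mult.commute)
  qed
  let ?N = "F `` {x}"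
  have NY: "?N \<subseteq> Y" using F by auto
  have finN: "finite ?N" using NY Y finite_subset by blast
  define U where "U = (\<Union>y\<in>?N. C y)"
  have "card U \<le> (\<Sum>y\<in>?N. card (C y))" unfolding U_def by (rule card_UN_le[OF finN])
  also have "\<dots> \<le> (\<Sum>y\<in>?N. L)" using C NY by (intro sum_mono) auto
  finally have "card U \<le> card ?N * L" by simp
  then have "real (card U) \<le> card ?N * real L" by (metis of_nat_mono of_nat_mult)
  also have "\<dots> \<le> D1 * L" using deg by (intro mult_right_mono) auto
  finally have cU: "card U \<le> D1 * L" .
  have finU: "finite U" unfolding U_def using finN C NY by blast
  have cW: "card (T \<union> U) \<le> k + D1 * L"
    using card_Un_le[of T U] T cU by linarith
  have "card (T \<union> U) \<le> N" using cW k \<open>m \<le> D1 * L\<close> par by linarith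
  then have "card (E \<inter> (T \<union> U) \<times> (T \<union> U)) \<le> \<delta> * card (T \<union> U)"
    using E finT finU unfolding sparse_upto_def by blast
  also have "\<dots> \<le> \<delta> * (k + D1 * L)" using cW par by simp
  finally have up: "card (E \<inter> (T \<union> U) \<times> (T \<union> U)) \<le> \<delta> * (k + D1 * L)" .
  let ?A = "SIGMA x':T. (?N \<inter> F `` {x'})"
  have "card T * \<eta> \<le> (\<Sum>x'\<in>T. real (card (?N \<inter> F `` {x'})))"
  proof -
    have "\<eta> \<le> card (?N \<inter> F `` {x'})" if "x' \<in> T" for x' using T(1) that by auto
    then show ?thesis using sum_mono[of T "\<lambda>_. \<eta>" "\<lambda>x'. real (card (?N \<inter> F `` {x'}))"] by simp
  qed
  also have "\<dots> = card ?A" using finT finN by simp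
  also have "card ?A \<le> card (E \<inter> (T \<union> U) \<times> (T \<union> U))"
  proof (rule card_le_cluster_edges[OF E(1) C(1)])
    show "?A \<subseteq> (T \<union> U) \<times> Y" using NY by auto
    fix x' y assume A: "(x', y) \<in> ?A"
    then obtain c where c: "c \<in> C y" "(x', c) \<in> E" using F by auto
    then show "\<exists>c\<in>C y. (x', c) \<in> E \<inter> (T \<union> U) \<times> (T \<union> U)"
      using A unfolding U_def by auto
  qed
  finally have "k * \<eta> \<le> \<delta> * (k + D1 * L)" using up T by simp
  \<comment> \<open>The term \<open>\<delta> * k\<close> is at most half of
    \<open>k * \<eta>\<close> and is absorbed on the left.\<close>
  moreover have "k * (2 * \<delta>) \<le> k * \<eta>" using par by (intro mult_left_mono) auto
  ultimately have "k * \<eta> \<le> 2 * \<delta> * (D1 * L)" by (simp add: algebra_simps)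
  then have "k \<le> m" unfolding m_def using \<eta> by (simp add: le_divide_eq)
  then show False using k by simp
qed

section \<open>Contracting stars\<close>

definition connected_rel :: "('v \<times> 'v) set \<Rightarrow> 'v set \<Rightarrow> bool" where
  "connected_rel E S \<longleftrightarrow> S \<noteq> {} \<and> (\<forall>u\<in>S. \<forall>v\<in>S. (u, v) \<in> (E \<inter> S \<times> S)\<^sup>*)"

text \<open>The contracted graph: being a set, it merges parallel edges, and
  \<open>x \<noteq> y\<close> removes the loops, so that it can be contracted again.\<close>

definition quotient_rel :: "('v \<times> 'v) set \<Rightarrow> ('w \<Rightarrow> 'v set) \<Rightarrow> 'w set \<Rightarrow> ('w \<times> 'w) set" where
  "quotient_rel E C V =
     {(x, y). x \<in> V \<and> y \<in> V \<and> x \<noteq> y \<and> (\<exists>u\<in>C x. \<exists>v\<in>C y. (u, v) \<in> E)}"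

text \<open>A system of branch sets. Vertices of \<open>W\<close> in no branch set count as deleted,
  so a round may discard whatever hinders it.\<close>

definition clustering ::
    "('v \<times> 'v) set \<Rightarrow> 'v set \<Rightarrow> ('w \<Rightarrow> 'v set) \<Rightarrow> 'w set \<Rightarrow> real \<Rightarrow> bool" where
  "clustering E W C V g \<longleftrightarrow> finite V \<and> V \<noteq> {} \<and> disjoint_family_on C V \<and>
     (\<forall>x\<in>V. C x \<subseteq> W \<and> finite (C x) \<and> real (card (C x)) \<le> g \<and> connected_rel E (C x))"

lemma connected_rel_singleton: "connected_rel E {x}"
  by (simp add: connected_rel_def)

lemma connected_rel_mono:
  assumes "connected_rel E S" "E \<subseteq> E'"
  shows "connected_rel E' S"
proof -
  have "(E \<inter> S \<times> S)\<^sup>* \<subseteq> (E' \<inter> S \<times> S)\<^sup>*" using assms by (intro rtrancl_mono) auto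
  then show ?thesis using assms unfolding connected_rel_def by blast
qed

lemma clustering_mono:
  "\<lbrakk>clustering E W C V g; E \<subseteq> E'; W \<subseteq> W'; g \<le> g'\<rbrakk> \<Longrightarrow> clustering E' W' C V g'"
  unfolding clustering_def by (meson connected_rel_mono order_trans)

lemma quotient_rel_mono: "E \<subseteq> E' \<Longrightarrow> quotient_rel E C V \<subseteq> quotient_rel E' C V"
  unfolding quotient_rel_def by auto

lemma finite_quotient_rel: "finite V \<Longrightarrow> finite (quotient_rel E C V)"
  by (rule finite_subset[of _ "V \<times> V"]) (auto simp: quotient_rel_def)

lemma sym_quotient_rel: "sym E \<Longrightarrow> sym (quotient_rel E C V)"
  unfolding quotient_rel_def sym_def by blast

lemma connected_rel_Un_leaves:
  assumes "connected_rel E S" "sym E" and leaf: "\<And>z. z \<in> Z \<Longrightarrow> \<exists>c\<in>S. (z, c) \<in> E"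
  shows "connected_rel E (S \<union> Z)"
proof -
  let ?R = "E \<inter> (S \<union> Z) \<times> (S \<union> Z)"
  have "(E \<inter> S \<times> S)\<^sup>* \<subseteq> ?R\<^sup>*" by (intro rtrancl_mono) auto
  then have S: "(u, v) \<in> ?R\<^sup>*" if "u \<in> S" "v \<in> S" for u v
    using assms(1) that unfolding connected_rel_def by blast
  have to: "\<exists>c\<in>S. (u, c) \<in> ?R\<^sup>* \<and> (c, u) \<in> ?R\<^sup>*" if u: "u \<in> S \<union> Z" for u
  proof (cases "u \<in> S")
    case False
    then obtain c where c: "c \<in> S" "(u, c) \<in> E" using u leaf by auto
    then have "(u, c) \<in> ?R" "(c, u) \<in> ?R" using u assms(2) by (auto dest: symD)
    then show ?thesis using c by blast
  qed auto
  have "(u, v) \<in> ?R\<^sup>*" if uv: "u \<in> S \<union> Z" "v \<in> S \<union> Z" for u v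
  proof -
    obtain b where b: "b \<in> S" "(u, b) \<in> ?R\<^sup>*" using to[OF uv(1)] by blast
    obtain c where c: "c \<in> S" "(c, v) \<in> ?R\<^sup>*" using to[OF uv(2)] by blast
    show ?thesis using b c S[OF b(1) c(1)] by (meson rtrancl_trans)
  qed
  then show ?thesis using assms(1) unfolding connected_rel_def by blast
qed

text \<open>Elements of \<open>X\<close> conflict when they see more than \<open>\<eta>\<close>
  common clusters; by \<open>few_mates\<close> each has at most d/4 conflicts. A leaf of a star
  centred in \<open>T\<close> therefore sees at least 3d/4 clusters of \<open>Y0\<close>, and
  overlaps inside a star cost at most d/4 per leaf, so the star sees about K d/2 clusters. Dividing
  by the size of \<open>Y0\<close>, at most twice that of \<open>T\<close>, gives the bound.\<close>

lemma star_contraction: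
  fixes E :: "('v \<times> 'v) set" and Y :: "'w set" and d D1 \<delta> N :: real and K L :: nat
  assumes E: "finite E" "sym E" "sparse_upto E N \<delta>"
    and X: "finite X" "X \<subseteq> W"
    and C: "clustering E W C Y L" "\<And>y. y \<in> Y \<Longrightarrow> C y \<inter> X = {}"
    and F: "F = {(x, y). x \<in> X \<and> y \<in> Y \<and> (\<exists>c\<in>C y. (x, c) \<in> E)}"
    and low: "\<And>x. x \<in> X \<Longrightarrow> d \<le> card (F `` {x})"
    and up: "\<And>x. x \<in> X \<Longrightarrow> card (E `` {x}) \<le> D1"
    and many: "(K + 1) * card Y < card X"
    and par: "1 \<le> K" "0 < \<delta>" "8 * K * \<delta> \<le> d" "32 * K * L * D1 * \<delta> \<le> d\<^sup>2"
      "3 * (D1 * L) \<le> N" "4 \<le> d"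
  shows "\<exists>C' (V' :: 'w set). clustering E W C' V' (L + K) \<and>
    K * d / 8 * card V' \<le> card (quotient_rel E C' V')"
proof -
  \<comment> \<open>This makes \<open>K * \<eta>\<close> a quarter of \<open>d\<close>; the
    hypotheses on \<open>8 * K * \<delta>\<close> and on \<open>d\<^sup>2\<close> then amount to
    \<open>2 * \<delta> \<le> \<eta>\<close> and \<open>\<mu> \<le> d / 4\<close>.\<close>
  define \<eta> where "\<eta> = d / (4 * K)"
  define \<mu> where "\<mu> = 2 * \<delta> * (D1 * L) / \<eta>"
  define R where "R x x' \<longleftrightarrow> \<eta> < card (F `` {x} \<inter> F `` {x'})" for x x'
  have Y: "finite Y" "Y \<noteq> {}" and disj: "disjoint_family_on C Y"
    and Cy: "\<And>y. y \<in> Y \<Longrightarrow> C y \<subseteq> W \<and> finite (C y) \<and> card (C y) \<le> L \<and> connected_rel E (C y)"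
    using C(1) unfolding clustering_def by auto
  obtain y where "y \<in> Y" using Y by auto
  then have "C y \<noteq> {}" "finite (C y)" "card (C y) \<le> L"
    using Cy unfolding connected_rel_def by auto
  then have L: "1 \<le> L" by (metis card_gt_0_iff leD less_one not_le order.strict_trans2)
  obtain x0 where x0: "x0 \<in> X" using many by fastforce
  have FE: "card (F `` {x}) \<le> card (E `` {x})" if "x \<in> X" for x
  proof -
    have "card ({x} \<times> F `` {x}) \<le> card (E \<inter> {x} \<times> UNIV)"
      by (rule card_le_cluster_edges[OF E(1) disj]) (auto simp: F)
    moreover have "E \<inter> {x} \<times> UNIV = {x} \<times> E `` {x}" by auto
    ultimately show ?thesis by (simp add: card_cartesian_product)
  qed
  have FD: "card (F `` {x}) \<le> D1" if "x \<in> X" for x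
    using FE[OF that] up[OF that] by linarith
  have D1: "4 \<le> D1" using low[OF x0] FD[OF x0] par by linarith
  have DL: "1 \<le> D1 * L" using D1 L mult_mono[of 1 D1 1 "real L"] by simp
  have \<eta>pos: "0 < \<eta>" unfolding \<eta>_def using par by simp
  have \<eta>2: "2 * \<delta> \<le> \<eta>" unfolding \<eta>_def using par by (simp add: field_simps)
  have \<mu>4: "\<mu> \<le> d / 4"
    unfolding \<mu>_def \<eta>_def using par by (simp add: field_simps power2_eq_square)
  have few: "card {x' \<in> X. x' \<noteq> x \<and> R x x'} \<le> \<mu>" if "x \<in> X" for x
    unfolding \<mu>_def R_def
    by (rule few_mates[OF E(1,3) X(1) Y(1) disj _ F FD[OF that] par(2) \<eta>2 DL par(5)])
      (use Cy in auto)
  have FXY: "F \<subseteq> X \<times> Y" using F by auto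
  have finF: "finite (F `` A)" for A
    by (rule finite_subset[OF _ Y(1)]) (use FXY in auto)
  have symR: "symp R" unfolding R_def symp_def by (simp add: Int_commute)
  have "\<mu> < d" using \<mu>4 par by linarith
  have "\<forall>x\<in>X. card {x' \<in> X. x' \<noteq> x \<and> R x x'} \<le> \<mu>" "\<forall>x\<in>X. d \<le> card (F `` {x})"
    using few low by auto
  from ex_balanced_assignment[OF X(1) Y(1) FXY symR this \<open>\<mu> < d\<close> many]
  obtain f T Y0 where T: "T \<noteq> {}" "T \<subseteq> Y0" "Y0 \<subseteq> Y" "card Y0 \<le> 2 * card T"
    and f0: "\<forall>x\<in>X. (x, f x) \<in> F"
      "\<forall>x\<in>X. \<forall>x'\<in>X. x' \<noteq> x \<and> R x x' \<longrightarrow> f x \<noteq> f x'"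
    and ld: "\<forall>y\<in>T. K \<le> card {x\<in>X. f x = y}"
    and near: "\<forall>x\<in>X. f x \<in> T \<longrightarrow> d - \<mu> \<le> card (F `` {x} \<inter> Y0)"
    by (elim exE conjE)
  have f: "\<And>x. x \<in> X \<Longrightarrow> (x, f x) \<in> F"
    "\<And>x x'. \<lbrakk>x \<in> X; x' \<in> X; x' \<noteq> x; R x x'\<rbrakk> \<Longrightarrow> f x \<noteq> f x'"
    using f0 by blast+
  have "\<exists>Z. Z \<subseteq> {x\<in>X. f x = y} \<and> card Z = K" if "y \<in> T" for y
    using ld that by (meson obtain_subset_with_card_n)
  then have "\<exists>Z. \<forall>y\<in>T. Z y \<subseteq> {x\<in>X. f x = y} \<and> card (Z y) = K"
    by (intro bchoice) auto
  then obtain Z where "\<forall>y\<in>T. Z y \<subseteq> {x\<in>X. f x = y} \<and> card (Z y) = K" ..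
  then have Z: "\<And>y. y \<in> T \<Longrightarrow> Z y \<subseteq> {x\<in>X. f x = y} \<and> card (Z y) = K"
    by blast
  have finZ: "finite (Z y)" if "y \<in> T" for y
    using Z[OF that] X by (auto intro: finite_subset)
  have finY0: "finite Y0" using T Y finite_subset by blast
  have finT: "finite T" using T finY0 finite_subset by blast
  \<comment> \<open>Clusters of \<open>Y0\<close> outside \<open>T\<close> gain no leaves; they are
    kept as the other ends of the new edges.\<close>
  define C' where "C' y = (if y \<in> T then C y \<union> Z y else C y)" for y
  have clus: "clustering E W C' Y0 (L + K)"
    unfolding clustering_def
  proof (intro conjI ballI)
    show "finite Y0" "Y0 \<noteq> {}" using finY0 T by auto
    show "disjoint_family_on C' Y0"
      unfolding disjoint_family_on_def
    proof (intro ballI impI)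
      fix y y' assume y: "y \<in> Y0" "y' \<in> Y0" "y \<noteq> y'"
      have "C y \<inter> C y' = {}" using disj y T unfolding disjoint_family_on_def by blast
      moreover have "y \<in> T \<Longrightarrow> Z y \<inter> C y' = {}" "y' \<in> T \<Longrightarrow> Z y' \<inter> C y = {}"
        using Z C(2) y T by blast+
      moreover have "\<lbrakk>y \<in> T; y' \<in> T\<rbrakk> \<Longrightarrow> Z y \<inter> Z y' = {}"
        using Z y by blast
      ultimately show "C' y \<inter> C' y' = {}" unfolding C'_def by auto
    qed
    fix y assume y: "y \<in> Y0"
    then have yY: "y \<in> Y" using T by auto
    show "C' y \<subseteq> W" using Cy[OF yY] Z[of y] X unfolding C'_def by (cases "y \<in> T") auto
    show "finite (C' y)" using Cy[OF yY] finZ unfolding C'_def by auto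
    have "card (C' y) \<le> L + K"
    proof (cases "y \<in> T")
      case True
      then show ?thesis using card_Un_le[of "C y" "Z y"] Cy[OF yY] Z[OF True] unfolding C'_def by simp
    qed (use Cy[OF yY] in \<open>simp add: C'_def\<close>)
    then show "real (card (C' y)) \<le> real (L + K)" by simp
    show "connected_rel E (C' y)"
    proof (cases "y \<in> T")
      case True
      have "\<exists>c\<in>C y. (z, c) \<in> E" if "z \<in> Z y" for z
        using Z[OF True] f[of z] that F by auto
      then show ?thesis using connected_rel_Un_leaves[of E "C y" "Z y"] Cy[OF yY] E(2) True
        unfolding C'_def by simp
    qed (use Cy[OF yY] in \<open>simp add: C'_def\<close>)
  qed
  \<comment> \<open>Removing \<open>y\<close> avoids a loop at the contracted star; the lost unit is
    paid for by \<open>1 \<le> K * d / 4\<close>.\<close>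
  let ?B = "\<lambda>y. (F `` Z y \<inter> Y0) - {y}"
  have big: "K * d / 4 \<le> card (?B y)" if y: "y \<in> T" for y
  proof -
    have cz: "card (Z y) = K" using Z[OF y] by simp
    have "card (Z y) * ((d - \<mu>) - card (Z y) * \<eta>) \<le> card (\<Union>x\<in>Z y. F `` {x} \<inter> Y0)"
    proof (rule card_UN_ge)
      fix x assume "x \<in> Z y"
      then show "d - \<mu> \<le> card (F `` {x} \<inter> Y0)" using near Z[OF y] y by auto
    next
      fix x x' assume x: "x \<in> Z y" "x' \<in> Z y" "x \<noteq> x'"
      then have "\<not> R x x'" using f(2)[of x x'] Z[OF y] by auto
      then have "card (F `` {x} \<inter> F `` {x'}) \<le> \<eta>" unfolding R_def by simp
      moreover have "card ((F `` {x} \<inter> Y0) \<inter> (F `` {x'} \<inter> Y0)) \<le> card (F `` {x} \<inter> F `` {x'})"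
        using finF by (intro card_mono) auto
      ultimately show "card ((F `` {x} \<inter> Y0) \<inter> (F `` {x'} \<inter> Y0)) \<le> \<eta>" by linarith
    qed (use finZ[OF y] \<eta>pos finF in auto)
    also have "(\<Union>x\<in>Z y. F `` {x} \<inter> Y0) = F `` Z y \<inter> Y0" by auto
    finally have "K * ((d - \<mu>) - K * \<eta>) \<le> card (F `` Z y \<inter> Y0)" unfolding cz .
    moreover have "K * (3 / 4 * d - K * \<eta>) \<le> K * ((d - \<mu>) - K * \<eta>)"
      using \<mu>4 by (intro mult_left_mono) auto
    moreover have "K * (3 / 4 * d - K * \<eta>) = K * d / 2"
      unfolding \<eta>_def using par by (simp add: field_simps)
    ultimately have h: "K * d / 2 \<le> card (F `` Z y \<inter> Y0)" by linarith
    have "card (F `` Z y \<inter> Y0) \<le> card (?B y) + 1"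
      by (cases "y \<in> F `` Z y \<inter> Y0") (auto simp: card_Diff_singleton_if)
    moreover have "1 \<le> K * d / 4" using par mult_mono[of 1 "real K" 4 d] by simp
    ultimately show ?thesis using h by linarith
  qed
  have sub: "(SIGMA y:T. ?B y) \<subseteq> quotient_rel E C' Y0"
  proof
    fix p assume "p \<in> (SIGMA y:T. ?B y)"
    then obtain y y' x where p: "p = (y, y')" "y \<in> T" "x \<in> Z y" "(x, y') \<in> F" "y' \<in> Y0" "y' \<noteq> y"
      by auto
    then obtain c where "c \<in> C y'" "(x, c) \<in> E" using F by auto
    then have "x \<in> C' y" "c \<in> C' y'" "(x, c) \<in> E" using p unfolding C'_def by auto
    then show "p \<in> quotient_rel E C' Y0"
      unfolding quotient_rel_def using p T by auto
  qed
  have "card T * (K * d / 4) \<le> (\<Sum>y\<in>T. real (card (?B y)))"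
    using sum_mono[of T "\<lambda>_. K * d / 4" "\<lambda>y. real (card (?B y))"] big by simp
  also have "\<dots> = card (SIGMA y:T. ?B y)" using finT finY0 by simp
  also have "\<dots> \<le> card (quotient_rel E C' Y0)"
    using card_mono[OF finite_quotient_rel[OF finY0] sub] by simp
  finally have q: "card T * (K * d / 4) \<le> card (quotient_rel E C' Y0)" .
  have "card Y0 * (K * d / 8) \<le> (2 * card T) * (K * d / 8)"
    using T par by (intro mult_right_mono) (auto simp flip: of_nat_mult)
  then have "K * d / 8 * card Y0 \<le> card (quotient_rel E C' Y0)"
    using q by (simp add: algebra_simps)
  then show ?thesis using clus by blast
qed

section \<open>One round of contraction\<close>

lemma card_Int_Times:
  assumes "finite A" "finite E"
  shows "card (E \<inter> A \<times> B) = (\<Sum>a\<in>A. card (E `` {a} \<inter> B))"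
proof -
  have "E \<inter> A \<times> B = (SIGMA a:A. E `` {a} \<inter> B)" by auto
  moreover have "finite (E `` {a} \<inter> B)" for a
    by (rule finite_subset[of _ "snd ` E"]) (use assms in force)+
  ultimately show ?thesis using assms by simp
qed

lemma card_Int_Times_sym:
  assumes "sym E"
  shows "card (E \<inter> A \<times> B) = card (E \<inter> B \<times> A)"
proof -
  have "(E \<inter> A \<times> B)\<inverse> = E \<inter> B \<times> A" using assms by (auto dest: symD)
  then show ?thesis by (metis card_inverse)
qed

lemma card_Int_insert_square:
  assumes "finite V" "finite E" "sym E" "v \<notin> V" "(v, v) \<notin> E"
  shows "card (E \<inter> insert v V \<times> insert v V) = card (E \<inter> V \<times> V) + 2 * card (E `` {v} \<inter> V)"
proof -
  have "E \<inter> insert v V \<times> insert v V = (E \<inter> V \<times> V) \<union> ((E \<inter> {v} \<times> V) \<union> (E \<inter> V \<times> {v}))"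
    using assms(5) by auto
  also have "card \<dots> = card (E \<inter> V \<times> V) + card ((E \<inter> {v} \<times> V) \<union> (E \<inter> V \<times> {v}))"
    using assms by (intro card_Un_disjoint) auto
  also have "card ((E \<inter> {v} \<times> V) \<union> (E \<inter> V \<times> {v})) = card (E \<inter> {v} \<times> V) + card (E \<inter> V \<times> {v})"
    using assms by (intro card_Un_disjoint) auto
  also have "card (E \<inter> V \<times> {v}) = card (E \<inter> {v} \<times> V)"
    by (rule card_Int_Times_sym[OF assms(3)])
  also have "card (E \<inter> {v} \<times> V) = card (E `` {v} \<inter> V)"
    using card_Int_Times[of "{v}" E V] assms by simp
  finally show ?thesis by simp
qed

text \<open>Vertices are added one at a time, each on the side opposite to at least half of its
  earlier neighbours.\<close>

lemma ex_half_cut: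
  assumes "finite V" "finite E" "sym E" "irrefl E" "E \<subseteq> V \<times> V"
  shows "\<exists>P. card E \<le> 2 * card {(x, y) \<in> E. x \<in> P \<longleftrightarrow> y \<notin> P}"
proof -
  define cut where "cut P = {(x, y) \<in> E. x \<in> P \<longleftrightarrow> y \<notin> P}" for P
  have fin: "finite (cut P)" for P
    by (rule finite_subset[OF _ assms(2)]) (auto simp: cut_def)
  have sym: "sym (cut P)" for P
    using assms(3) unfolding cut_def sym_def by auto
  have irr: "(v, v) \<notin> E" "(v, v) \<notin> cut P" for v P
    using assms(4) unfolding cut_def irrefl_def by auto
  have "\<exists>P. card (E \<inter> V \<times> V) \<le> 2 * card (cut P \<inter> V \<times> V)"
    using assms(1)
  proof (induction V rule: finite_induct)
    case (insert v V)
    then obtain P where P: "card (E \<inter> V \<times> V) \<le> 2 * card (cut P \<inter> V \<times> V)" by blast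
    let ?N = "E `` {v} \<inter> V"
    have finN: "finite ?N" using insert by simp
    have same: "cut Q \<inter> V \<times> V = cut P \<inter> V \<times> V" if "Q \<inter> V = P \<inter> V" for Q
      using that unfolding cut_def by blast
    have exp: "card (cut Q \<inter> insert v V \<times> insert v V)
        = card (cut P \<inter> V \<times> V) + 2 * card (cut Q `` {v} \<inter> V)" if "Q \<inter> V = P \<inter> V" for Q
      using card_Int_insert_square[OF insert.hyps(1) fin sym insert.hyps(2) irr(2)] same[OF that] by simp
    have ex: "card (E \<inter> insert v V \<times> insert v V) = card (E \<inter> V \<times> V) + 2 * card ?N"
      by (rule card_Int_insert_square[OF insert.hyps(1) assms(2,3) insert.hyps(2) irr(1)])
    have c1: "cut (insert v P) `` {v} \<inter> V = ?N - P"
      using insert.hyps unfolding cut_def by auto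
    have c2: "cut (P - {v}) `` {v} \<inter> V = ?N \<inter> P"
      using insert.hyps unfolding cut_def by auto
    have i: "insert v P \<inter> V = P \<inter> V" "(P - {v}) \<inter> V = P \<inter> V" using insert.hyps by auto
    have "card ?N = card (?N - P) + card (?N \<inter> P)"
      by (metis card_Int_Diff finN add.commute)
    then consider "card ?N \<le> 2 * card (?N - P)" | "card ?N \<le> 2 * card (?N \<inter> P)" by linarith
    then show ?case
    proof cases
      case 1
      then show ?thesis using exp[OF i(1)] ex P c1 by (intro exI[of _ "insert v P"]) simp
    next
      case 2
      then show ?thesis using exp[OF i(2)] ex P c2 by (intro exI[of _ "P - {v}"]) simp
    qed
  qed simp
  then obtain P where "card (E \<inter> V \<times> V) \<le> 2 * card (cut P \<inter> V \<times> V)" ..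
  moreover have "E \<inter> V \<times> V = E" "cut P \<inter> V \<times> V = cut P" using assms(5) by (auto simp: cut_def)
  ultimately show ?thesis unfolding cut_def by auto
qed

text \<open>In a subset with the most ordered pairs per vertex, deleting \<open>v\<close> removes
  one vertex and twice its degree in pairs and cannot raise the ratio; this forces the minimum
  degree. The bound for all other subsets is exported because it later shows certain sets to be
  large.\<close>

lemma ex_densest_subset:
  assumes "finite V" "V \<noteq> {}" "finite E" "sym E" "irrefl E"
  shows "\<exists>W \<rho> :: real. W \<subseteq> V \<and> W \<noteq> {} \<and> card (E \<inter> W \<times> W) = \<rho> * card W \<and>
    (\<forall>S\<subseteq>V. card (E \<inter> S \<times> S) \<le> \<rho> * card S) \<and> (\<forall>v\<in>W. \<rho> / 2 \<le> card (E `` {v} \<inter> W))"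
proof -
  define r where "r S = real (card (E \<inter> S \<times> S)) / card S" for S
  have fin: "finite (r ` (Pow V - {{}}))" using assms(1) by simp
  have ne: "r ` (Pow V - {{}}) \<noteq> {}" using assms(2) by auto
  from Max_in[OF fin ne] obtain W where W: "W \<subseteq> V" "W \<noteq> {}" "Max (r ` (Pow V - {{}})) = r W"
    by auto
  have finW: "finite W" using W assms(1) finite_subset by blast
  have top: "card (E \<inter> S \<times> S) \<le> r W * card S" if "S \<subseteq> V" for S
  proof (cases "S = {}")
    case False
    then have "r S \<le> r W" using Max_ge[OF fin, of "r S"] W that by simp
    moreover have "0 < card S" using False that assms(1) by (meson card_gt_0_iff finite_subset)
    ultimately show ?thesis by (simp add: r_def[of S] divide_le_eq)
  qed simp
  have eq: "card (E \<inter> W \<times> W) = r W * card W"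
    using W finW by (simp add: r_def)
  have "r W / 2 \<le> card (E `` {v} \<inter> W)" if v: "v \<in> W" for v
  proof -
    have irr: "(v, v) \<notin> E" using assms(5) by (simp add: irrefl_def)
    have "insert v (W - {v}) = W" using v by auto
    then have c: "card (E \<inter> W \<times> W)
        = card (E \<inter> (W - {v}) \<times> (W - {v})) + 2 * card (E `` {v} \<inter> (W - {v}))"
      using card_Int_insert_square[of "W - {v}" E v] assms finW irr by simp
    have "E `` {v} \<inter> (W - {v}) = E `` {v} \<inter> W" using irr by auto
    moreover have "card (E \<inter> (W - {v}) \<times> (W - {v})) \<le> r W * card (W - {v})"
      using W by (intro top) auto
    moreover have "real (card (W - {v})) = real (card W) - 1"
      using card_Suc_Diff1[OF finW v] by linarith
    ultimately have "r W * card W \<le> r W * (real (card W) - 1) + 2 * card (E `` {v} \<inter> W)"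
      using c eq by (metis (no_types, lifting) add_right_mono of_nat_add of_nat_mult of_nat_numeral)
    then show ?thesis by (simp add: algebra_simps)
  qed
  then show ?thesis using W eq top by blast
qed

text \<open>A bipartite graph whose degrees lie in \<open>[d, \<Gamma> d]\<close> is first contracted along a maximal family of
  disjoint stars with \<open>L\<close> leaves; the centres are so few that the stars must cover half of the leaf
  side, and the other side is then much larger than the set of stars.\<close>

lemma near_regular_contraction:
  fixes E :: "('v \<times> 'v) set" and d \<delta> N :: real and K L \<Gamma> :: nat
  assumes E: "finite E" "sym E" "sparse_upto E N \<delta>" and W: "finite W" "W \<noteq> {}" "E \<subseteq> W \<times> W"
    and bip: "\<And>x y. (x, y) \<in> E \<Longrightarrow> x \<in> P \<longleftrightarrow> y \<notin> P"
    and deg: "\<And>v. v \<in> W \<Longrightarrow> d \<le> card (E `` {v})" "\<And>v. v \<in> W \<Longrightarrow> card (E `` {v}) \<le> \<Gamma> * d"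
    and Ldef: "L = 16 * \<Gamma> ^ 3 * (K + 2)"
    and par: "1 \<le> K" "1 \<le> \<Gamma>" "1 \<le> \<delta>"
      "8192 * K * \<Gamma> ^ 3 * (L + 1) * \<delta> \<le> d" "20 * \<Gamma>\<^sup>2 * L\<^sup>2 * \<delta> \<le> d" "3 * (\<Gamma> * d * (L + 1)) \<le> N"
  shows "\<exists>C (V :: 'v set). clustering E W C V (L + 1 + K) \<and>
    K * d / (128 * \<Gamma>) * card V \<le> card (quotient_rel E C V)"
proof -
  \<comment> \<open>\<open>A0\<close> is the side of the centres, \<open>R\<close> the side of the
    leaves; the degree bounds make their sizes equal up to a factor \<open>\<Gamma>\<close>.\<close>
  define A0 where "A0 = W \<inter> P"
  define R where "R = W - P"
  have fin: "finite A0" "finite R" unfolding A0_def R_def using W by auto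
  have EA: "E `` {p} \<subseteq> R" if "p \<in> A0" for p
    using that bip W unfolding A0_def R_def by blast
  have ER: "E `` {z} \<subseteq> A0" if "z \<in> R" for z
    using that bip W unfolding A0_def R_def by blast
  have finE: "finite (E `` S)" for S
    by (rule finite_subset[OF _ W(1)]) (use W(3) in auto)
  have \<Gamma>3: "\<Gamma> \<le> \<Gamma> ^ 3" using par(2) self_le_power[of \<Gamma> 3] by simp
  have "4 * \<Gamma> * 1 \<le> 16 * \<Gamma> ^ 3 * (K + 2)" using \<Gamma>3 by (intro mult_mono) auto
  then have L4: "4 * \<Gamma> \<le> L" unfolding Ldef by simp
  then have L1: "1 \<le> L" using par by simp
  have Lr: "4 * real \<Gamma> \<le> L" "1 \<le> real L" "1 \<le> real \<Gamma>" "1 \<le> real K"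
    using L4 L1 par by (simp_all flip: of_nat_mult)
  have \<Gamma>3r: "real \<Gamma> \<le> real \<Gamma> ^ 3" using \<Gamma>3 by (metis of_nat_le_iff of_nat_power)
  have dbig: "8192 * real \<Gamma> * K * \<delta> \<le> d"
  proof -
    have "8192 * real \<Gamma> * K * \<delta> \<le> 8192 * real \<Gamma> ^ 3 * K * \<delta>"
      using \<Gamma>3r par by (intro mult_right_mono) auto
    also have "\<dots> \<le> 8192 * real \<Gamma> ^ 3 * K * \<delta> * (real L + 1)"
      using par mult_left_mono[of 1 "real L + 1" "8192 * real \<Gamma> ^ 3 * K * \<delta>"] by simp
    also have "\<dots> = 8192 * K * \<Gamma> ^ 3 * (L + 1) * \<delta>" by (simp add: algebra_simps)
    finally show ?thesis using par(4) by linarith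
  qed
  have g1: "real \<Gamma> \<le> real \<Gamma> * K * \<delta>"
  proof -
    have "1 \<le> K * \<delta>" using Lr par(3) mult_mono[of 1 "real K" 1 \<delta>] by simp
    then show ?thesis using mult_left_mono[of 1 "K * \<delta>" "real \<Gamma>"] by (simp add: mult_ac)
  qed
  have d64: "64 * real \<Gamma> \<le> d" using dbig g1 Lr by linarith
  have d0: "0 < d" using d64 Lr by linarith
  \<comment> \<open>With overlaps at most \<open>\<eta>\<close>, the \<open>L\<close> leaves of a
    star have at least \<open>L * d / 2\<close> neighbours altogether, half of the ideal
    number.\<close>
  define \<eta> where "\<eta> = d / (2 * L)"
  have \<eta>: "0 < \<eta>" unfolding \<eta>_def using d0 Lr by simp
  have dL: "20 * (\<Gamma> * L) * (\<Gamma> * L * \<delta>) \<le> d" using par(5) by (simp add: power2_eq_square mult_ac)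
  have GL: "1 \<le> real \<Gamma> * L" using Lr mult_mono[of 1 "real \<Gamma>" 1 "real L"] by simp
  have Ld: "L * \<delta> \<le> (\<Gamma> * L) * (\<Gamma> * L * \<delta>)"
  proof -
    have "real L * \<delta> \<le> \<Gamma> * L * \<delta>" using Lr par(3) by simp
    also have "\<dots> \<le> (\<Gamma> * L) * (\<Gamma> * L * \<delta>)"
      using mult_right_mono[OF GL, of "\<Gamma> * L * \<delta>"] par(3) by simp
    finally show ?thesis .
  qed
  have \<eta>2: "2 * \<delta> \<le> \<eta>"
  proof -
    have "0 \<le> real L * \<delta>" using par by simp
    then have "4 * (L * \<delta>) \<le> d" using Ld dL by linarith
    then show ?thesis unfolding \<eta>_def using Lr by (simp add: field_simps)
  qed
  define M where "M z z' \<longleftrightarrow> \<eta> < card (E `` {z} \<inter> E `` {z'})" for z z'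
  have symM: "symp M" unfolding M_def symp_def by (simp add: Int_commute)
  \<comment> \<open>The bound of \<open>few_mates\<close> for singleton clusters and degrees up to
    \<open>\<Gamma> * d\<close>, with this \<open>\<eta>\<close>.\<close>
  define m where "m = nat \<lfloor>4 * \<delta> * \<Gamma> * L\<rfloor>"
  have m: "m \<le> 4 * \<delta> * \<Gamma> * L" unfolding m_def using par by simp
  have \<Gamma>d: "1 \<le> \<Gamma> * d" using d64 Lr mult_mono[of 1 "real \<Gamma>" 1 d] by linarith
  have N3: "3 * (\<Gamma> * d) \<le> N"
  proof -
    have "\<Gamma> * d * 1 \<le> \<Gamma> * d * (L + 1)" using \<Gamma>d by (intro mult_left_mono) auto
    then show ?thesis using par(6) by linarith
  qed
  have few: "card {z' \<in> W. z' \<noteq> z \<and> M z z'} \<le> m" if z: "z \<in> W" for z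
  proof -
    have "card {x' \<in> W. x' \<noteq> z \<and> \<eta> < card (E `` {z} \<inter> E `` {x'})} \<le> 2 * \<delta> * (\<Gamma> * d * (1 :: nat)) / \<eta>"
    proof (rule few_mates[OF E(1,3) W(1) W(1), of "\<lambda>y. {y}"])
      show "disjoint_family_on (\<lambda>y. {y}) W" by (auto simp: disjoint_family_on_def)
      show "E = {(x, y). x \<in> W \<and> y \<in> W \<and> (\<exists>c\<in>{y}. (x, c) \<in> E)}" using W(3) by auto
    qed (use deg(2)[OF z] par \<eta>2 \<Gamma>d N3 in auto)
    also have "\<dots> = 4 * \<delta> * \<Gamma> * L" unfolding \<eta>_def using d0 Lr by (simp add: field_simps)
    finally have "card {z' \<in> W. z' \<noteq> z \<and> M z z'} \<le> 4 * \<delta> * \<Gamma> * L" unfolding M_def .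
    then show ?thesis unfolding m_def by linarith
  qed
  \<comment> \<open>A family is a pair of a set of centres and a map to leaf sets. Leaves of one
    star must overlap little, so that a star really has about \<open>L\<close> times the degree of a
    vertex.\<close>
  define fam where "fam q \<longleftrightarrow> fst q \<subseteq> A0 \<and> disjoint_family_on (snd q) (fst q) \<and>
    (\<forall>p\<in>fst q. snd q p \<subseteq> E `` {p} \<and> card (snd q p) = L \<and>
      (\<forall>x\<in>snd q p. \<forall>y\<in>snd q p. x \<noteq> y \<longrightarrow> \<not> M x y))" for q :: "'v set \<times> ('v \<Rightarrow> 'v set)"
  have "fam ({}, \<lambda>_. {})" by (simp add: fam_def disjoint_family_on_def)
  moreover have "\<forall>q. fam q \<longrightarrow> card (fst q) < card A0 + 1"
    using card_mono[OF fin(1)] by (auto simp: fam_def less_Suc_eq_le)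
  ultimately have "\<exists>q. fam q \<and> (\<forall>q'. fam q' \<longrightarrow> card (fst q') \<le> card (fst q))"
    by (rule ex_has_greatest_nat)
  then obtain A Z where AZ: "fam (A, Z)" and best: "\<And>A' Z'. fam (A', Z') \<Longrightarrow> card A' \<le> card A"
    by auto
  have A: "A \<subseteq> A0" and Zd: "disjoint_family_on Z A"
    and Z: "\<And>p. p \<in> A \<Longrightarrow> Z p \<subseteq> E `` {p}" "\<And>p. p \<in> A \<Longrightarrow> card (Z p) = L"
      "\<And>p x y. \<lbrakk>p \<in> A; x \<in> Z p; y \<in> Z p; x \<noteq> y\<rbrakk> \<Longrightarrow> \<not> M x y"
    using AZ unfolding fam_def by auto
  have finA: "finite A" using A fin finite_subset by blast
  have ZR: "Z p \<subseteq> R" if "p \<in> A" for p using Z(1)[OF that] EA A that by blast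
  have finZ: "finite (Z p)" if "p \<in> A" for p using ZR[OF that] fin finite_subset by blast
  define R1 where "R1 = (\<Union>p\<in>A. Z p)"
  define R2 where "R2 = R - R1"
  have R1: "R1 \<subseteq> R" unfolding R1_def using ZR by blast
  have "card R1 = (\<Sum>p\<in>A. card (Z p))"
    unfolding R1_def using finA finZ Zd unfolding disjoint_family_on_def
    by (intro card_UN_disjoint) auto
  also have "\<dots> = card A * L" using Z(2) by simp
  finally have cR1: "card R1 = card A * L" .
  have cR12: "card R = card R1 + card R2"
    unfolding R2_def using R1 fin by (metis card_Diff_subset card_mono finite_subset le_add_diff_inverse)
  \<comment> \<open>Otherwise the greedy choice finds \<open>L\<close> pairwise compatible uncovered
    leaves at \<open>p\<close>, and one more star fits.\<close>
  have fresh: "card (E `` {p} \<inter> R2) \<le> L * (m + 1)" if p: "p \<in> A0" "p \<notin> A" for p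
  proof (rule ccontr)
    assume "\<not> ?thesis"
    then have large: "L * (m + 1) \<le> card (E `` {p} \<inter> R2)" by simp
    have "\<exists>Y\<subseteq>E `` {p} \<inter> R2. card Y = L \<and> (\<forall>x\<in>Y. \<forall>y\<in>Y. x \<noteq> y \<longrightarrow> \<not> M x y)"
    proof (rule ex_independent_subset[OF _ symM _ large])
      show "finite (E `` {p} \<inter> R2)" using finE by simp
      fix a assume a: "a \<in> E `` {p} \<inter> R2"
      then have "a \<in> W" unfolding R2_def R_def by auto
      have "card {b \<in> E `` {p} \<inter> R2. b \<noteq> a \<and> M a b} \<le> card {z' \<in> W. z' \<noteq> a \<and> M a z'}"
        unfolding R2_def R_def using W by (intro card_mono) auto
      then show "card {b \<in> E `` {p} \<inter> R2. b \<noteq> a \<and> M a b} \<le> m"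
        using few[OF \<open>a \<in> W\<close>] by linarith
    qed
    then obtain Y where Y: "Y \<subseteq> E `` {p} \<inter> R2" "card Y = L"
      "\<forall>x\<in>Y. \<forall>y\<in>Y. x \<noteq> y \<longrightarrow> \<not> M x y" by blast
    have "fam (insert p A, Z(p := Y))"
      unfolding fam_def fst_conv snd_conv
    proof (intro conjI ballI)
      show "insert p A \<subseteq> A0" using p A by simp
      show "disjoint_family_on (Z(p := Y)) (insert p A)"
        using Zd Y(1) p(2) unfolding disjoint_family_on_def R2_def R1_def by auto
      fix q assume q: "q \<in> insert p A"
      show "(Z(p := Y)) q \<subseteq> E `` {q}" using q Y(1) Z(1) by auto
      show "card ((Z(p := Y)) q) = L" using q Y(2) Z(2) by auto
      fix x y assume "x \<in> (Z(p := Y)) q" "y \<in> (Z(p := Y)) q"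
      then show "x \<noteq> y \<longrightarrow> \<not> M x y"
        using q Y(3) Z(3)[of q x y] by (cases "q = p") auto
    qed
    then show False using best p finA by fastforce
  qed
  have sumdeg: "card (E \<inter> S \<times> T) \<le> card S * (\<Gamma> * d)" if "S \<subseteq> W" for S T
  proof -
    have "finite S" using that W finite_subset by blast
    have "real (card (E \<inter> S \<times> T)) = (\<Sum>a\<in>S. real (card (E `` {a} \<inter> T)))"
      using card_Int_Times[OF \<open>finite S\<close> E(1)] by simp
    also have "\<dots> \<le> (\<Sum>a\<in>S. \<Gamma> * d)"
    proof (rule sum_mono)
      fix a assume "a \<in> S"
      have "card (E `` {a} \<inter> T) \<le> card (E `` {a})" using finE by (intro card_mono) auto
      then show "card (E `` {a} \<inter> T) \<le> \<Gamma> * d" using deg(2)[of a] \<open>a \<in> S\<close> that by force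
    qed
    finally show ?thesis by simp
  qed
  have sumlow: "card S * d \<le> card (E \<inter> S \<times> T)" if "S \<subseteq> W" "\<And>a. a \<in> S \<Longrightarrow> E `` {a} \<subseteq> T" for S T
  proof -
    have "finite S" using that W finite_subset by blast
    have "card S * d = (\<Sum>a\<in>S. d)" by simp
    also have "\<dots> \<le> (\<Sum>a\<in>S. real (card (E `` {a} \<inter> T)))"
    proof (rule sum_mono)
      fix a assume a: "a \<in> S"
      then have "E `` {a} \<inter> T = E `` {a}" using that(2) by blast
      then show "d \<le> real (card (E `` {a} \<inter> T))" using deg(1)[of a] a that(1) by auto
    qed
    also have "\<dots> = real (card (E \<inter> S \<times> T))"
      using card_Int_Times[OF \<open>finite S\<close> E(1)] by simp
    finally show ?thesis .
  qed
  have subW: "A0 \<subseteq> W" "R \<subseteq> W" "A \<subseteq> W" "R2 \<subseteq> W" using A unfolding A0_def R_def R2_def by auto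
  have "card A0 * d \<le> card (E \<inter> A0 \<times> R)" using sumlow[OF subW(1)] EA by blast
  also have "\<dots> = card (E \<inter> R \<times> A0)" using card_Int_Times_sym[OF E(2)] by simp
  also have "\<dots> \<le> card R * (\<Gamma> * d)" by (rule sumdeg[OF subW(2)])
  finally have A0R: "card A0 \<le> \<Gamma> * card R" using d0 by (simp add: mult_ac flip: of_nat_mult)
  have "card R * d \<le> card (E \<inter> R \<times> A0)" using sumlow[OF subW(2)] ER by blast
  also have "\<dots> = card (E \<inter> A0 \<times> R)" using card_Int_Times_sym[OF E(2)] by simp
  also have "\<dots> \<le> card A0 * (\<Gamma> * d)" by (rule sumdeg[OF subW(1)])
  finally have RA0: "card R \<le> \<Gamma> * card A0" using d0 by (simp add: mult_ac flip: of_nat_mult)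
  have "card W = card A0 + card R"
    unfolding A0_def R_def using W by (metis card_Int_Diff add.commute)
  moreover have "card W > 0" using W by (simp add: card_gt_0_iff)
  ultimately have Rpos: "0 < card R" using A0R by (cases "card R") auto
  have AL: "card A * L \<le> card R" using cR1 cR12 by simp
  then have ALr: "card A * real L \<le> card R" by (metis of_nat_le_iff of_nat_mult)
  \<comment> \<open>Edges at the uncovered part \<open>R2\<close> are counted from
    \<open>A0\<close>. The centres are few, as \<open>4 * \<Gamma> \<le> L\<close>, and all other
    vertices see little of \<open>R2\<close> by \<open>fresh\<close>; each kind contributes at most
    a quarter of \<open>card R * d\<close>, so \<open>R2\<close> is at most half of
    \<open>R\<close>.\<close>
  have "card R2 * d \<le> card (E \<inter> R2 \<times> A0)"
    by (rule sumlow[OF subW(4)]) (use ER R2_def in blast)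
  also have "\<dots> = card (E \<inter> A0 \<times> R2)" using card_Int_Times_sym[OF E(2)] by simp
  finally have low2: "card R2 * d \<le> card (E \<inter> A0 \<times> R2)" .
  have "E \<inter> A0 \<times> R2 = (E \<inter> A \<times> R2) \<union> (E \<inter> (A0 - A) \<times> R2)" using A by auto
  then have split: "card (E \<inter> A0 \<times> R2) \<le> card (E \<inter> A \<times> R2) + card (E \<inter> (A0 - A) \<times> R2)"
    by (metis card_Un_le)
  have "card (E \<inter> (A0 - A) \<times> R2) = (\<Sum>p\<in>A0 - A. card (E `` {p} \<inter> R2))"
    using fin E by (intro card_Int_Times) auto
  also have "\<dots> \<le> (\<Sum>p\<in>A0 - A. L * (m + 1))" using fresh by (intro sum_mono) auto
  also have "\<dots> \<le> card A0 * (L * (m + 1))" using fin by (simp add: card_mono mult_right_mono)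
  finally have "card (E \<inter> A0 \<times> R2) \<le> card (E \<inter> A \<times> R2) + card A0 * (L * (m + 1))"
    using split by linarith
  then have "real (card (E \<inter> A0 \<times> R2)) \<le> real (card (E \<inter> A \<times> R2) + card A0 * (L * (m + 1)))"
    by (rule of_nat_mono)
  moreover have "card (E \<inter> A \<times> R2) \<le> card A * (\<Gamma> * d)" by (rule sumdeg[OF subW(3)])
  ultimately have r2: "card R2 * d \<le> card A * (\<Gamma> * d) + card A0 * (L * (real m + 1))"
    using low2 by (simp add: algebra_simps)
  have "card A * (\<Gamma> * d) \<le> card R * d / 4"
  proof -
    have "card A * (4 * real \<Gamma>) \<le> card A * real L" using Lr by (intro mult_left_mono) auto
    then have "card A * (4 * real \<Gamma>) * d \<le> card R * d" using ALr d0 by (intro mult_right_mono) auto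
    then show ?thesis by simp
  qed
  moreover have "card A0 * (L * (real m + 1)) \<le> card R * d / 4"
  proof -
    have one: "1 \<le> \<delta> * \<Gamma> * L" using GL par(3) mult_mono[of 1 \<delta> 1 "real \<Gamma> * L"] by (simp add: mult_ac)
    have "real m + 1 \<le> 5 * (\<delta> * \<Gamma> * L)" using m one by linarith
    then have Lm: "L * (real m + 1) \<le> L * (5 * (\<delta> * \<Gamma> * L))" by (intro mult_left_mono) auto
    have "real (card A0) \<le> \<Gamma> * card R" using A0R by (metis of_nat_le_iff)
    then have "card A0 * (L * (real m + 1)) \<le> (\<Gamma> * card R) * (L * (5 * (\<delta> * \<Gamma> * L)))"
      by (rule mult_mono[OF _ Lm]) auto
    also have "\<dots> = card R * (20 * (\<Gamma> * L) * (\<Gamma> * L * \<delta>)) / 4" by (simp add: mult_ac)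
    also have "\<dots> \<le> card R * d / 4" using mult_left_mono[OF dL, of "real (card R)"] by linarith
    finally show ?thesis .
  qed
  ultimately have "card R2 * d \<le> (card R / 2) * d" using r2 by simp
  then have "card R2 \<le> card R / 2" using d0 by (simp add: mult_le_cancel_right)
  then have R1half: "card R / 2 \<le> card R1" using cR12 by simp
  then have Ane: "A \<noteq> {}" using cR1 Rpos by auto

  define X0 where "X0 = A0 - A"
  define C where "C p = insert p (Z p)" for p
  define F where "F = {(x, y). x \<in> X0 \<and> y \<in> A \<and> (\<exists>c\<in>C y. (x, c) \<in> E)}"
  let ?Q = "SIGMA p:A. E `` Z p"
  have nb: "L * d / 2 \<le> card (E `` Z p)" if p: "p \<in> A" for p
  proof -
    have "card (Z p) * (d - card (Z p) * \<eta>) \<le> card (\<Union>x\<in>Z p. E `` {x})"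
    proof (rule card_UN_ge)
      fix x assume "x \<in> Z p"
      then show "d \<le> card (E `` {x})" using deg(1)[of x] ZR[OF p] subW by auto
    next
      fix x y assume "x \<in> Z p" "y \<in> Z p" "x \<noteq> y"
      then show "card (E `` {x} \<inter> E `` {y}) \<le> \<eta>" using Z(3)[OF p] unfolding M_def by fastforce
    qed (use finZ[OF p] \<eta> finE in auto)
    moreover have "(\<Union>x\<in>Z p. E `` {x}) = E `` Z p" by auto
    moreover have "L * (d - L * \<eta>) = L * d / 2" unfolding \<eta>_def using Lr by (simp add: field_simps)
    ultimately show ?thesis using Z(2)[OF p] by simp
  qed
  have "card A * (L * d / 2) \<le> (\<Sum>p\<in>A. real (card (E `` Z p)))"
    using sum_mono[of A "\<lambda>_. L * d / 2" "\<lambda>p. real (card (E `` Z p))"] nb by simp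
  also have "\<dots> = card ?Q" using finA finE by simp
  finally have Qlow: "card A * (L * d / 2) \<le> card ?Q" .
  have QA: "q \<in> A0" if "p \<in> A" "q \<in> E `` Z p" for p q using that ZR ER by blast
  have finQ: "finite ?Q" using finA finE by auto
  \<comment> \<open>Neighbours of stars that are themselves centres cannot become leaves. As
    \<open>4 * \<Gamma> \<le> L\<close>, they cost at most half of the lower bound for
    \<open>?Q\<close>.\<close>
  let ?Q1 = "{(q, p). p \<in> A \<and> q \<in> A \<and> q \<in> E `` Z p}"
  have finF: "finite F"
    by (rule finite_subset[of _ "A0 \<times> A"]) (auto simp: F_def X0_def fin finA)
  have "?Q\<inverse> \<subseteq> ?Q1 \<union> F"
    using QA E(2) unfolding F_def X0_def C_def by (auto dest: symD)
  moreover have "finite ?Q1" by (rule finite_subset[of _ "A \<times> A"]) (auto simp: finA)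
  ultimately have "card (?Q\<inverse>) \<le> card (?Q1 \<union> F)" using finF by (intro card_mono) auto
  also have "\<dots> \<le> card ?Q1 + card F" by (rule card_Un_le)
  also have "card ?Q1 \<le> card (E \<inter> A \<times> UNIV)"
  proof (rule card_le_cluster_edges[OF E(1) Zd])
    show "?Q1 \<subseteq> A \<times> A" by auto
    fix q p assume "(q, p) \<in> ?Q1"
    then show "\<exists>c\<in>Z p. (q, c) \<in> E \<inter> A \<times> UNIV" using E(2) by (auto dest: symD)
  qed
  finally have "card ?Q \<le> card (E \<inter> A \<times> UNIV) + card F" by (simp add: card_inverse)
  then have "real (card ?Q) \<le> card (E \<inter> A \<times> UNIV) + card F" by (metis of_nat_le_iff of_nat_add)
  also have "\<dots> \<le> card A * (\<Gamma> * d) + card F" using sumdeg[OF subW(3)] by simp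
  finally have "card A * (L * d / 2) \<le> card A * (\<Gamma> * d) + card F" using Qlow by linarith
  moreover have "card A * (\<Gamma> * d) \<le> card A * (L * d / 4)"
    using Lr d0 by (intro mult_left_mono) (auto simp: mult_right_mono)
  ultimately have "card A * (L * d / 4) \<le> card F" by (simp add: field_simps)
  moreover have "card R / 2 * (d / 4) \<le> card A * real L * (d / 4)"
    using R1half d0 unfolding cR1 by (intro mult_right_mono) auto
  ultimately have F8: "card R * d / 8 \<le> card F" by (simp add: mult_ac)
  have "card A0 * d \<le> \<Gamma> * card R * d" using A0R d0 by (simp flip: of_nat_mult)
  then have "card A0 * d / (8 * \<Gamma>) \<le> card R * d / 8" using Lr by (simp add: field_simps)
  then have Flow: "card A0 * d / (8 * \<Gamma>) \<le> card F" using F8 by linarith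

  \<comment> \<open>Half of the average guaranteed by \<open>Flow\<close>: vertices below
    \<open>d3\<close> carry at most half of that guarantee, so those above it, of degree at most
    \<open>\<Gamma> * d\<close>, make up at least 1/(16 \<open>\<Gamma>\<^sup>2\<close>) of
    \<open>A0\<close>.\<close>
  define d3 where "d3 = d / (16 * \<Gamma>)"
  define X where "X = {q \<in> X0. d3 \<le> card (F `` {q})}"
  have finX0: "finite X0" "X0 \<subseteq> W" unfolding X0_def using fin subW by auto
  have d3: "0 < d3" unfolding d3_def using d0 Lr by simp
  have Cd: "disjoint_family_on C A"
    unfolding disjoint_family_on_def
  proof (intro ballI impI)
    fix p q assume pq: "p \<in> A" "q \<in> A" "p \<noteq> q"
    have "Z p \<inter> Z q = {}" using Zd pq unfolding disjoint_family_on_def by blast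
    moreover have "p \<notin> Z q" "q \<notin> Z p" using ZR pq A unfolding A0_def R_def by auto
    ultimately show "C p \<inter> C q = {}" unfolding C_def using pq by auto
  qed
  have Fup: "card (F `` {q}) \<le> \<Gamma> * d" if q: "q \<in> X0" for q
  proof -
    have "card ({q} \<times> F `` {q}) \<le> card (E \<inter> {q} \<times> UNIV)"
      by (rule card_le_cluster_edges[OF E(1) Cd]) (auto simp: F_def)
    then have "card (F `` {q}) \<le> card (E \<inter> {q} \<times> UNIV)" by (simp add: card_cartesian_product)
    then show ?thesis using sumdeg[of "{q}" UNIV] q finX0 by force
  qed
  have "real (card F) = (\<Sum>q\<in>X0. real (card (F `` {q})))"
  proof -
    have "F \<inter> X0 \<times> UNIV = F" unfolding F_def by auto
    then show ?thesis using card_Int_Times[OF finX0(1) finF, of UNIV] by simp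
  qed
  also have "\<dots> \<le> (\<Sum>q\<in>X0. (if q \<in> X then \<Gamma> * d else 0) + d3)"
    using Fup d3 unfolding X_def by (intro sum_mono) force
  also have "\<dots> = card X * (\<Gamma> * d) + card X0 * d3"
  proof -
    have "X0 \<inter> {q. q \<in> X} = X" unfolding X_def by auto
    then show ?thesis using finX0 by (simp add: sum.distrib sum.If_cases)
  qed
  also have "card X0 * d3 \<le> card A0 * d3"
    unfolding X0_def using fin d3 by (intro mult_right_mono) (auto intro: card_mono)
  finally have "card A0 * d / (8 * \<Gamma>) \<le> card X * (\<Gamma> * d) + card A0 * d3" using Flow by linarith
  moreover have "card A0 * d / (8 * \<Gamma>) = 2 * (card A0 * d3)" unfolding d3_def using Lr by simp
  ultimately have "card A0 * d3 \<le> card X * (\<Gamma> * d)" by linarith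
  then have "real (card A0) \<le> 16 * real \<Gamma> ^ 2 * card X"
    unfolding d3_def using d0 Lr by (simp add: field_simps power2_eq_square)
  then have XA0: "card A0 \<le> 16 * \<Gamma> ^ 2 * card X"
    by (metis (mono_tags, lifting) of_nat_le_iff of_nat_mult of_nat_numeral of_nat_power)
  \<comment> \<open>The origin of \<open>L\<close>: one factor \<open>\<Gamma>\<close> from
    comparing the two sides, \<open>16 * \<Gamma> ^ 2\<close> from \<open>XA0\<close>, and
    \<open>K + 2\<close> to obtain the strict inequality with \<open>K + 1\<close>.\<close>
  have "card A * L \<le> \<Gamma> * card A0" using AL RA0 by linarith
  also have "\<dots> \<le> \<Gamma> * (16 * \<Gamma> ^ 2 * card X)" using XA0 by simp
  finally have "(16 * \<Gamma> ^ 3) * ((K + 2) * card A) \<le> (16 * \<Gamma> ^ 3) * card X"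
    unfolding Ldef by (simp add: power2_eq_square power3_eq_cube algebra_simps)
  then have "(K + 2) * card A \<le> card X" using par(2) by (simp only: mult_le_cancel1) simp
  moreover have "0 < card A" using Ane finA by (simp add: card_gt_0_iff)
  ultimately have many: "(K + 1) * card A < card X" by (simp add: algebra_simps)

  have clus: "clustering E W C A (real (L + 1))"
    unfolding clustering_def
  proof (intro conjI ballI)
    fix p assume p: "p \<in> A"
    show "C p \<subseteq> W" using p subW ZR[OF p] unfolding C_def by auto
    show "finite (C p)" using finZ[OF p] unfolding C_def by simp
    show "real (card (C p)) \<le> real (L + 1)"
      using finZ[OF p] Z(2)[OF p] unfolding C_def by (simp add: card_insert_if)
    have "connected_rel E ({p} \<union> Z p)"
      by (rule connected_rel_Un_leaves[OF connected_rel_singleton E(2)])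
        (use Z(1)[OF p] E(2) in \<open>auto dest: symD\<close>)
    then show "connected_rel E (C p)" unfolding C_def by simp
  qed (use finA Ane Cd in auto)
  have XX0: "X \<subseteq> X0" unfolding X_def by auto
  have "\<exists>C' (V' :: 'v set). clustering E W C' V' (real (L + 1 + K)) \<and>
      K * d3 / 8 * card V' \<le> card (quotient_rel E C' V')"
  proof (rule star_contraction[OF E _ _ clus _ refl, where X = X])
    show "finite X" "X \<subseteq> W" using XX0 finX0 finite_subset by auto
    show "C y \<inter> X = {}" if "y \<in> A" for y
      using that XX0 ZR[OF that] unfolding C_def X0_def A0_def R_def by auto
    show "d3 \<le> card ({(x, y). x \<in> X \<and> y \<in> A \<and> (\<exists>c\<in>C y. (x, c) \<in> E)} `` {x})" if "x \<in> X" for x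
    proof -
      have "{(x, y). x \<in> X \<and> y \<in> A \<and> (\<exists>c\<in>C y. (x, c) \<in> E)} `` {x} = F `` {x}"
        using that XX0 unfolding F_def by auto
      then show ?thesis using that unfolding X_def by simp
    qed
    show "card (E `` {x}) \<le> \<Gamma> * d" if "x \<in> X" for x using deg(2)[of x] that XX0 finX0 by auto
    show "8 * K * \<delta> \<le> d3"
    proof -
      have "128 * real \<Gamma> * K * \<delta> \<le> d" using dbig g1 by linarith
      then show ?thesis unfolding d3_def using Lr by (simp add: field_simps)
    qed
    show "32 * K * (L + 1) * (\<Gamma> * d) * \<delta> \<le> d3\<^sup>2"
    proof -
      have "8192 * K * \<Gamma> ^ 3 * (L + 1) * \<delta> * d \<le> d * d" using par(4) d0 by (intro mult_right_mono) auto
      then show ?thesis unfolding d3_def using Lr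
        by (simp add: field_simps power2_eq_square power3_eq_cube)
    qed
    show "4 \<le> d3" unfolding d3_def using d64 Lr by (simp add: field_simps)
  qed (use many par in auto)
  moreover have "K * d3 / 8 = K * d / (128 * \<Gamma>)" unfolding d3_def by simp
  ultimately show ?thesis by simp
qed

text \<open>The two alternatives correspond to huge degrees and to an almost regular part.
  \<open>D\<close> bounds the average degree \<open>\<rho>\<close> of the densest part and thereby
  the neighbourhoods that must fit into \<open>N\<close>. The two star sizes are independent, so
  that \<open>K2\<close> can be adapted to \<open>\<Gamma>\<close>.\<close>

lemma contraction_step:
  fixes E :: "('v \<times> 'v) set" and \<rho>0 \<delta> N D :: real and K1 K2 \<Lambda> \<Gamma> L :: nat
  assumes V: "finite V" "V \<noteq> {}" and E: "E \<subseteq> V \<times> V" "sym E" "irrefl E" "sparse_upto E N \<delta>"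
    and dense: "\<rho>0 * card V \<le> card E"
    and top: "\<And>S. S \<subseteq> V \<Longrightarrow> card (E \<inter> S \<times> S) \<le> D * card S"
    and \<Lambda>: "\<Lambda> = 16 * (K1 + 2)" and \<Gamma>: "\<Gamma> = 4 * \<Lambda>" and L: "L = 16 * \<Gamma> ^ 3 * (K2 + 2)"
    and par: "1 \<le> K1" "1 \<le> K2" "1 \<le> \<delta>"
      "65536 * real K2 * \<Gamma> ^ 3 * (L + 1) * \<delta> \<le> \<rho>0" "160 * real \<Gamma> ^ 2 * L\<^sup>2 * \<delta> \<le> \<rho>0"
      "16384 * real K1 * \<Lambda> * \<delta> \<le> \<rho>0" "3 * \<Lambda> * D \<le> N" "\<Gamma> * D * (L + 1) \<le> N"
  shows "\<exists>C (V' :: 'v set).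
    clustering E V C V' (K1 + 1) \<and> K1 * \<rho>0 / 256 * card V' \<le> card (quotient_rel E C V') \<or>
    clustering E V C V' (L + 1 + K2) \<and> K2 * \<rho>0 / (1024 * \<Gamma>) * card V' \<le> card (quotient_rel E C V')"
proof -
  have finE: "finite E" using E V by (meson finite_SigmaI finite_subset)
  obtain P where P: "card E \<le> 2 * card {(x, y) \<in> E. x \<in> P \<longleftrightarrow> y \<notin> P}"
    using ex_half_cut[OF V(1) finE E(2,3,1)] by blast
  define E1 where "E1 = {(x, y) \<in> E. x \<in> P \<longleftrightarrow> y \<notin> P}"
  have E1: "E1 \<subseteq> E" "sym E1" "irrefl E1"
    using E unfolding E1_def sym_def irrefl_def by auto
  have finE1: "finite E1" using E1 finE finite_subset by blast
  from ex_densest_subset[OF V finE1 E1(2,3)]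
  obtain W and \<rho> :: real where W: "W \<subseteq> V" "W \<noteq> {}" and cW: "card (E1 \<inter> W \<times> W) = \<rho> * card W"
    and max: "\<forall>S\<subseteq>V. card (E1 \<inter> S \<times> S) \<le> \<rho> * card S"
    by (elim exE conjE)
  have finW: "finite W" using W V finite_subset by blast
  have npos: "0 < real (card W)" using W finW by (simp add: card_gt_0_iff)
  have \<rho>low: "\<rho>0 / 2 \<le> \<rho>"
  proof -
    have "E1 \<inter> V \<times> V = E1" using E1 E by auto
    then have "real (card E1) \<le> \<rho> * card V" using max[rule_format, of V] by simp
    moreover have "real (card E) \<le> 2 * real (card E1)" using P unfolding E1_def by linarith
    ultimately have "\<rho>0 * card V \<le> (2 * \<rho>) * card V" using dense by linarith
    moreover have "0 < real (card V)" using V by (simp add: card_gt_0_iff)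
    ultimately show ?thesis by (simp add: mult_le_cancel_right)
  qed
  have \<rho>up: "\<rho> \<le> D"
  proof -
    have "card (E1 \<inter> W \<times> W) \<le> card (E \<inter> W \<times> W)" using E1 finE by (intro card_mono) auto
    then have "\<rho> * card W \<le> D * card W" using cW top[OF W(1)] by linarith
    then show ?thesis using npos by (simp add: mult_le_cancel_right)
  qed
  have \<Lambda>48: "48 \<le> real \<Lambda>" using par unfolding \<Lambda> by simp
  have K1\<delta>: "1 \<le> real K1 * \<delta>" using par mult_mono[of 1 "real K1" 1 \<delta>] by simp
  have \<rho>0big: "16384 * (\<Lambda> * (K1 * \<delta>)) \<le> \<rho>0" using par(6) by (simp add: mult_ac)
  have "real \<Lambda> * 1 \<le> \<Lambda> * (K1 * \<delta>)" using K1\<delta> by (intro mult_left_mono) auto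
  then have \<rho>64: "64 \<le> \<rho>" and \<rho>pos: "0 < \<rho>" using \<rho>0big \<rho>low \<Lambda>48 by linarith+
  define E2 where "E2 = E1 \<inter> W \<times> W"
  have E2: "E2 \<subseteq> E" "sym E2" "irrefl E2" "finite E2" "E2 \<subseteq> W \<times> W"
    using E1 finE1 unfolding E2_def sym_def irrefl_def by auto
  have sp2: "sparse_upto E2 N \<delta>" by (rule sparse_upto_subset[OF E(4) E2(1) finE])
  have cE2: "card E2 = \<rho> * card W" using cW unfolding E2_def by simp
  have finI: "finite (E2 `` S)" for S
    by (rule finite_subset[OF _ finW]) (use E2 in auto)
  define B where "B = {v \<in> W. \<Lambda> * \<rho> < card (E2 `` {v})}"
  define S where "S = W - B"
  have BS: "B \<subseteq> W" "S \<subseteq> W" "finite B" "finite S" "B \<inter> S = {}" "W = S \<union> B"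
    using finW unfolding B_def S_def by auto
  have Sdeg: "card (E2 `` {v}) \<le> \<Lambda> * \<rho>" if "v \<in> S" for v using that unfolding S_def B_def by auto
  have cB: "real (card B) * \<Lambda> \<le> card W"
  proof -
    have "card B * (\<Lambda> * \<rho>) = (\<Sum>v\<in>B. \<Lambda> * \<rho>)" by simp
    also have "\<dots> \<le> (\<Sum>v\<in>B. real (card (E2 `` {v} \<inter> UNIV)))"
      unfolding B_def by (intro sum_mono) auto
    also have "\<dots> = real (card (E2 \<inter> B \<times> UNIV))"
      using card_Int_Times[OF BS(3) E2(4), of UNIV] by simp
    also have "\<dots> \<le> card E2" using E2 by (simp add: card_mono)
    finally have "(real (card B) * \<Lambda>) * \<rho> \<le> card W * \<rho>" using cE2 by (simp add: mult_ac)
    then show ?thesis using \<rho>pos by (simp add: mult_le_cancel_right)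
  qed
  have "real (card B) * 48 \<le> real (card B) * \<Lambda>" using \<Lambda>48 by (intro mult_left_mono) auto
  then have B48: "48 * real (card B) \<le> card W" using cB by linarith
  have split: "E2 = (E2 \<inter> S \<times> S \<union> E2 \<inter> S \<times> B) \<union> (E2 \<inter> B \<times> S \<union> E2 \<inter> B \<times> B)"
    using E2(5) BS(6) by auto
  have "card E2 \<le> (card (E2 \<inter> S \<times> S) + card (E2 \<inter> S \<times> B)) + (card (E2 \<inter> B \<times> S) + card (E2 \<inter> B \<times> B))"
    using card_Un_le[of "E2 \<inter> S \<times> S \<union> E2 \<inter> S \<times> B" "E2 \<inter> B \<times> S \<union> E2 \<inter> B \<times> B"]
      card_Un_le[of "E2 \<inter> S \<times> S" "E2 \<inter> S \<times> B"] card_Un_le[of "E2 \<inter> B \<times> S" "E2 \<inter> B \<times> B"]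
    unfolding split[symmetric] by linarith
  moreover have "card (E2 \<inter> B \<times> S) = card (E2 \<inter> S \<times> B)" by (rule card_Int_Times_sym[OF E2(2)])
  moreover have "card (E2 \<inter> B \<times> B) \<le> \<rho> * card B"
  proof -
    have "E2 \<inter> B \<times> B = E1 \<inter> B \<times> B" using BS unfolding E2_def by auto
    moreover have "B \<subseteq> V" using BS W by auto
    ultimately show ?thesis using max[rule_format, of B] by simp
  qed
  ultimately have total: "\<rho> * card W \<le> card (E2 \<inter> S \<times> S) + 2 * real (card (E2 \<inter> S \<times> B)) + \<rho> * card B"
    using cE2 by linarith
  have "\<rho> * (48 * real (card B)) \<le> \<rho> * card W" using B48 \<rho>pos by (intro mult_left_mono) auto
  then have \<rho>B: "48 * (\<rho> * card B) \<le> \<rho> * card W" by simp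
  show ?thesis
  \<comment> \<open>If the test fails, \<open>total\<close> leaves at least 1 - 2/8 - 1/48 of all
    pairs, more than half, inside \<open>S\<close>.\<close>
  proof (cases "\<rho> * card W / 8 \<le> card (E2 \<inter> S \<times> B)")
    case True
    define X where "X = {x \<in> S. \<rho> / 16 \<le> card (E2 `` {x} \<inter> B)}"
    have finX: "finite X" "X \<subseteq> S" using BS unfolding X_def by auto
    have "real (card (E2 \<inter> S \<times> B)) = (\<Sum>x\<in>S. real (card (E2 `` {x} \<inter> B)))"
      using card_Int_Times[OF BS(4) E2(4)] by simp
    also have "\<dots> \<le> (\<Sum>x\<in>S. (if x \<in> X then real (card (E2 `` {x} \<inter> B)) else 0) + \<rho> / 16)"
      using \<rho>pos unfolding X_def by (intro sum_mono) auto
    also have "\<dots> = (\<Sum>x\<in>X. real (card (E2 `` {x} \<inter> B))) + card S * (\<rho> / 16)"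
    proof -
      have "S \<inter> {x. x \<in> X} = X" using finX by auto
      then show ?thesis using BS by (simp add: sum.distrib sum.If_cases)
    qed
    also have "(\<Sum>x\<in>X. real (card (E2 `` {x} \<inter> B))) = card (E2 \<inter> X \<times> B)"
      using card_Int_Times[OF finX(1) E2(4)] by simp
    finally have "\<rho> * card W / 8 \<le> card (E2 \<inter> X \<times> B) + card S * (\<rho> / 16)" using True by linarith
    moreover have "card S * (\<rho> / 16) \<le> card W * (\<rho> / 16)"
      using BS finW \<rho>pos by (intro mult_right_mono) (auto intro: card_mono)
    ultimately have XB: "\<rho> * card W / 16 \<le> card (E2 \<inter> X \<times> B)" by (simp add: algebra_simps)
    \<comment> \<open>Maximality of \<open>W\<close> makes \<open>X\<close> large: both directions
      together give at least \<open>\<rho> * card W / 8\<close> pairs on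
      \<open>X \<union> B\<close>, whose average degree is at most \<open>\<rho>\<close>. So
      \<open>X \<union> B\<close> has at least an eighth of the vertices, and \<open>B\<close> is
      too small to provide them.\<close>
    have "card ((E2 \<inter> X \<times> B) \<union> (E2 \<inter> B \<times> X)) = card (E2 \<inter> X \<times> B) + card (E2 \<inter> B \<times> X)"
      using E2 BS finX by (intro card_Un_disjoint) auto
    moreover have "card ((E2 \<inter> X \<times> B) \<union> (E2 \<inter> B \<times> X)) \<le> card (E1 \<inter> (X \<union> B) \<times> (X \<union> B))"
      using finE1 unfolding E2_def by (intro card_mono) auto
    moreover have "card (E2 \<inter> B \<times> X) = card (E2 \<inter> X \<times> B)" by (rule card_Int_Times_sym[OF E2(2)])
    moreover have "X \<union> B \<subseteq> V" using finX BS W by blast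
    then have "card (E1 \<inter> (X \<union> B) \<times> (X \<union> B)) \<le> \<rho> * card (X \<union> B)" by (rule max[rule_format])
    ultimately have "2 * real (card (E2 \<inter> X \<times> B)) \<le> \<rho> * card (X \<union> B)" by linarith
    then have "\<rho> * card W \<le> \<rho> * (8 * card (X \<union> B))" using XB by simp
    then have "real (card W) \<le> 8 * card (X \<union> B)" using \<rho>pos by (simp add: mult_le_cancel_left)
    moreover have "card (X \<union> B) \<le> card X + card B" by (rule card_Un_le)
    ultimately have "real (card W) \<le> 16 * card X" using B48 by linarith
    then have "real (card B * \<Lambda>) \<le> real (16 * card X)" using cB by simp
    then have "card B * \<Lambda> \<le> 16 * card X" by (simp only: of_nat_le_iff)
    then have KX: "(K1 + 2) * card B \<le> card X" unfolding \<Lambda> by (simp add: algebra_simps)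
    have Bne: "B \<noteq> {}" using True npos \<rho>pos by (auto simp: zero_less_mult_iff divide_le_0_iff mult_le_0_iff)
    then have "0 < card B" using BS by (simp add: card_gt_0_iff)
    then have many: "(K1 + 1) * card B < card X" using KX by (simp add: algebra_simps)
    have clus: "clustering E2 W (\<lambda>y. {y}) B (real (1 :: nat))"
      using BS Bne unfolding clustering_def disjoint_family_on_def by (auto simp: connected_rel_singleton)
    have "\<exists>C' (V' :: 'v set). clustering E2 W C' V' (real (1 + K1)) \<and>
        K1 * (\<rho> / 16) / 8 * card V' \<le> card (quotient_rel E2 C' V')"
    proof (rule star_contraction[OF E2(4) E2(2) sp2 finX(1) _ clus _ refl])
      show "X \<subseteq> W" using finX BS by auto
      show "{y} \<inter> X = {}" if "y \<in> B" for y using that finX BS by auto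
      show "\<rho> / 16 \<le> card ({(x, y). x \<in> X \<and> y \<in> B \<and> (\<exists>c\<in>{y}. (x, c) \<in> E2)} `` {x})" if "x \<in> X" for x
      proof -
        have "{(x, y). x \<in> X \<and> y \<in> B \<and> (\<exists>c\<in>{y}. (x, c) \<in> E2)} `` {x} = E2 `` {x} \<inter> B"
          using that by auto
        then show ?thesis using that unfolding X_def by simp
      qed
      \<comment> \<open>Only leaves need bounded degree; the huge degrees in \<open>B\<close> occur
        at centres alone.\<close>
      show "card (E2 `` {x}) \<le> \<Lambda> * \<rho>" if "x \<in> X" for x using Sdeg that finX by auto
      have big: "8192 * (\<Lambda> * (K1 * \<delta>)) \<le> \<rho>" using \<rho>0big \<rho>low by linarith
      have "K1 * \<delta> \<le> \<Lambda> * (K1 * \<delta>)" using \<Lambda>48 K1\<delta> mult_right_mono[of 1 "real \<Lambda>" "K1 * \<delta>"] by simp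
      then show "8 * K1 * \<delta> \<le> \<rho> / 16" using big K1\<delta> by simp
      have "8192 * (\<Lambda> * (K1 * \<delta>)) * \<rho> \<le> \<rho> * \<rho>" using big \<rho>pos by (intro mult_right_mono) auto
      then show "32 * K1 * (1 :: nat) * (\<Lambda> * \<rho>) * \<delta> \<le> (\<rho> / 16)\<^sup>2"
        by (simp add: power2_eq_square field_simps)
      have "\<Lambda> * \<rho> \<le> \<Lambda> * D" using \<rho>up by (intro mult_left_mono) auto
      then show "3 * (\<Lambda> * \<rho> * (1 :: nat)) \<le> N" using par(7) by simp
    qed (use many par \<rho>64 in auto)
    then obtain C' and V' :: "'v set" where C': "clustering E2 W C' V' (real (1 + K1))"
      "K1 * (\<rho> / 16) / 8 * card V' \<le> card (quotient_rel E2 C' V')" by blast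
    have finV': "finite V'" using C' unfolding clustering_def by blast
    have "clustering E V C' V' (K1 + 1)" by (rule clustering_mono[OF C'(1) E2(1) W(1)]) simp
    moreover have "K1 * \<rho>0 / 256 * card V' \<le> card (quotient_rel E C' V')"
    proof -
      have "K1 * \<rho>0 / 256 * card V' \<le> K1 * (\<rho> / 16) / 8 * card V'"
        using \<rho>low mult_left_mono[of "\<rho>0 / 2" \<rho> "real K1"] by (intro mult_right_mono) (auto simp: mult_ac)
      also have "\<dots> \<le> card (quotient_rel E2 C' V')" by (rule C'(2))
      also have "\<dots> \<le> card (quotient_rel E C' V')"
        using card_mono[OF finite_quotient_rel[OF finV'] quotient_rel_mono[OF E2(1)]] by simp
      finally show ?thesis .
    qed
    ultimately show ?thesis by blast
  next
    case False
    then have SS: "\<rho> * card W / 2 \<le> card (E2 \<inter> S \<times> S)" using total \<rho>B by linarith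
    have Sne: "S \<noteq> {}"
    proof
      assume "S = {}"
      then have "\<rho> * card W \<le> 0" using SS by simp
      then show False using mult_pos_pos[OF \<rho>pos npos] by linarith
    qed
    \<comment> \<open>Passing to a densest subset again restores a minimum degree,
      \<open>\<rho> / 4\<close>; the maximum degree in \<open>S\<close> is at most
      \<open>\<Lambda> * \<rho>\<close>, which explains
      \<open>\<Gamma> = 4 * \<Lambda>\<close>.\<close>
    from ex_densest_subset[OF BS(4) Sne E2(4,2,3)]
    obtain W2 and \<rho>2 :: real where W2: "W2 \<subseteq> S" "W2 \<noteq> {}"
      and max2: "\<forall>T\<subseteq>S. card (E2 \<inter> T \<times> T) \<le> \<rho>2 * card T"
      and min2: "\<forall>v\<in>W2. \<rho>2 / 2 \<le> card (E2 `` {v} \<inter> W2)"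
      by (elim exE conjE)
    have up2: "card (E2 \<inter> S \<times> S) \<le> \<rho>2 * card S" by (rule max2[rule_format]) simp
    have "0 < \<rho> * card W" using \<rho>pos npos by simp
    then have "0 < \<rho>2 * card S" using SS up2 by linarith
    then have \<rho>2pos: "0 < \<rho>2" by (simp add: zero_less_mult_iff)
    have "\<rho>2 * card S \<le> \<rho>2 * card W" using \<rho>2pos BS finW by (intro mult_left_mono) (auto intro: card_mono)
    then have "(\<rho> / 2) * card W \<le> \<rho>2 * card W" using SS up2 by simp
    then have \<rho>2: "\<rho> / 2 \<le> \<rho>2" using npos by (simp add: mult_le_cancel_right)
    define E3 where "E3 = E2 \<inter> W2 \<times> W2"
    have E3: "E3 \<subseteq> E" "sym E3" "finite E3" "E3 \<subseteq> W2 \<times> W2"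
      using E2 unfolding E3_def sym_def by auto
    have I3: "E3 `` {v} = E2 `` {v} \<inter> W2" if "v \<in> W2" for v using that unfolding E3_def by auto
    have "\<exists>C (V' :: 'v set). clustering E3 W2 C V' (real (L + 1 + K2)) \<and>
        K2 * (\<rho> / 4) / (128 * \<Gamma>) * card V' \<le> card (quotient_rel E3 C V')"
    proof (rule near_regular_contraction[OF E3(3,2) sparse_upto_subset[OF E(4) E3(1) finE] _ W2(2) E3(4) _ _ _ L])
      show "finite W2" using W2 BS finite_subset by blast
      show "(x \<in> P) = (y \<notin> P)" if "(x, y) \<in> E3" for x y
        using that unfolding E3_def E2_def E1_def by auto
      show "\<rho> / 4 \<le> card (E3 `` {v})" if "v \<in> W2" for v
        using bspec[OF min2 that] \<rho>2 unfolding I3[OF that] by linarith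
      show "card (E3 `` {v}) \<le> \<Gamma> * (\<rho> / 4)" if v: "v \<in> W2" for v
      proof -
        have "card (E3 `` {v}) \<le> card (E2 `` {v})" using finI unfolding I3[OF v] by (intro card_mono) auto
        moreover have "card (E2 `` {v}) \<le> \<Lambda> * \<rho>" using v W2 by (intro Sdeg) auto
        ultimately show ?thesis unfolding \<Gamma> by simp
      qed
      show "8192 * K2 * \<Gamma> ^ 3 * (L + 1) * \<delta> \<le> \<rho> / 4" using par(4) \<rho>low by (simp add: algebra_simps)
      show "20 * \<Gamma>\<^sup>2 * L\<^sup>2 * \<delta> \<le> \<rho> / 4" using par(5) \<rho>low by simp
      have "\<Gamma> * \<rho> * (L + 1) \<le> \<Gamma> * D * (L + 1)" using \<rho>up by (intro mult_mono) (use \<rho>pos in auto)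
      moreover have "0 \<le> \<Gamma> * \<rho> * (L + 1)" using \<rho>pos by simp
      ultimately show "3 * (\<Gamma> * (\<rho> / 4) * (L + 1)) \<le> N" using par(8) by simp
      show "1 \<le> \<Gamma>" unfolding \<Gamma> \<Lambda> by simp
    qed (use par in auto)
    then obtain C' and V' :: "'v set" where C': "clustering E3 W2 C' V' (real (L + 1 + K2))"
      "K2 * (\<rho> / 4) / (128 * \<Gamma>) * card V' \<le> card (quotient_rel E3 C' V')" by blast
    have finV': "finite V'" using C' unfolding clustering_def by blast
    have "W2 \<subseteq> V" using W2 BS W by blast
    then have "clustering E V C' V' (L + 1 + K2)" by (rule clustering_mono[OF C'(1) E3(1)]) simp
    moreover have "K2 * \<rho>0 / (1024 * \<Gamma>) * card V' \<le> card (quotient_rel E C' V')"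
    proof -
      have "K2 * \<rho>0 / (1024 * \<Gamma>) * card V' = K2 * (\<rho>0 / 2) / (512 * \<Gamma>) * card V'" by simp
      also have "\<dots> \<le> K2 * \<rho> / (512 * \<Gamma>) * card V'"
        using \<rho>low by (intro mult_right_mono divide_right_mono mult_left_mono) auto
      also have "\<dots> = K2 * (\<rho> / 4) / (128 * \<Gamma>) * card V'" by simp
      also have "\<dots> \<le> card (quotient_rel E3 C' V')" by (rule C'(2))
      also have "\<dots> \<le> card (quotient_rel E C' V')"
        using card_mono[OF finite_quotient_rel[OF finV'] quotient_rel_mono[OF E3(1)]] by simp
      finally show ?thesis .
    qed
    ultimately show ?thesis by blast
  qed
qed

section \<open>Iterated contraction\<close>

text \<open>A walk in the contracted graph lifts to the original one: consecutive witnessing edges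
  are joined inside the connected inner branch sets.\<close>

lemma clustering_compose:
  assumes B: "clustering E W B V M" and C: "clustering (quotient_rel E B V) V C V' g" and "0 \<le> M"
  shows "clustering E W (\<lambda>x. \<Union>c\<in>C x. B c) V' (M * g)"
proof -
  have Bd: "disjoint_family_on B V"
    and Bx: "\<And>c. c \<in> V \<Longrightarrow> B c \<subseteq> W \<and> finite (B c) \<and> card (B c) \<le> M \<and> connected_rel E (B c)"
    using B unfolding clustering_def by auto
  have Cd: "disjoint_family_on C V'" and V': "finite V'" "V' \<noteq> {}"
    and Cx: "\<And>x. x \<in> V' \<Longrightarrow> C x \<subseteq> V \<and> finite (C x) \<and> card (C x) \<le> g \<and>
      connected_rel (quotient_rel E B V) (C x)"
    using C unfolding clustering_def by auto
  show ?thesis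
    unfolding clustering_def
  proof (intro conjI ballI)
    show "finite V'" "V' \<noteq> {}" by (rule V')+
    show "disjoint_family_on (\<lambda>x. \<Union>c\<in>C x. B c) V'"
      unfolding disjoint_family_on_def
    proof (intro ballI impI)
      fix x y assume xy: "x \<in> V'" "y \<in> V'" "x \<noteq> y"
      have Cxy: "C x \<inter> C y = {}" by (rule disjoint_family_onD[OF Cd xy])
      have "C x \<subseteq> V" "C y \<subseteq> V" using Cx[OF xy(1)] Cx[OF xy(2)] by auto
      then have "B c \<inter> B c' = {}" if "c \<in> C x" "c' \<in> C y" for c c'
        using that Cxy by (intro disjoint_family_onD[OF Bd]) auto
      then show "(\<Union>c\<in>C x. B c) \<inter> (\<Union>c\<in>C y. B c) = {}" by blast
    qed
    fix x assume x: "x \<in> V'"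
    have CV: "C x \<subseteq> V" "finite (C x)" "card (C x) \<le> g"
      and conn: "connected_rel (quotient_rel E B V) (C x)" using Cx[OF x] by auto
    let ?U = "\<Union>c\<in>C x. B c"
    show "?U \<subseteq> W" using CV Bx by blast
    show "finite ?U" by (rule finite_UN_I[OF CV(2)]) (use CV(1) Bx in auto)
    have "real (card ?U) \<le> (\<Sum>c\<in>C x. real (card (B c)))"
      using card_UN_le[OF CV(2), of B] by (metis of_nat_le_iff of_nat_sum)
    also have "\<dots> \<le> (\<Sum>c\<in>C x. M)" using Bx CV by (intro sum_mono) auto
    also have "\<dots> = M * card (C x)" by simp
    also have "\<dots> \<le> M * g" using CV assms(3) by (intro mult_left_mono) auto
    finally show "real (card ?U) \<le> M * g" .
    let ?R = "E \<inter> ?U \<times> ?U"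
    have inner: "(u, v) \<in> ?R\<^sup>*" if "c \<in> C x" "u \<in> B c" "v \<in> B c" for c u v
    proof -
      have "(E \<inter> B c \<times> B c)\<^sup>* \<subseteq> ?R\<^sup>*" using that(1) by (intro rtrancl_mono) auto
      moreover have "connected_rel E (B c)" using Bx CV that(1) by blast
      ultimately show ?thesis using that unfolding connected_rel_def by blast
    qed
    have path: "(u, v) \<in> ?R\<^sup>*"
      if "(c, c') \<in> (quotient_rel E B V \<inter> C x \<times> C x)\<^sup>*" "c \<in> C x" "u \<in> B c" "v \<in> B c'" for c c' u v
      using that(1,4)
    proof (induction arbitrary: v rule: rtrancl_induct)
      case base
      then show ?case using inner that by blast
    next
      case (step c' c'')
      then obtain a b where ab: "a \<in> B c'" "b \<in> B c''" "(a, b) \<in> E" and cc: "c' \<in> C x" "c'' \<in> C x"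
        unfolding quotient_rel_def by blast
      have "(u, a) \<in> ?R\<^sup>*" using step.IH ab by blast
      moreover have "(a, b) \<in> ?R" using ab cc by blast
      moreover have "(b, v) \<in> ?R\<^sup>*" using inner[OF cc(2)] ab step.prems by blast
      ultimately show ?case by (meson rtrancl.rtrancl_into_rtrancl rtrancl_trans)
    qed
    obtain c where c: "c \<in> C x" using conn unfolding connected_rel_def by blast
    then have "B c \<noteq> {}" using Bx CV unfolding connected_rel_def by blast
    then have "?U \<noteq> {}" using c by blast
    moreover have "(u, v) \<in> ?R\<^sup>*" if uv: "u \<in> ?U" "v \<in> ?U" for u v
    proof -
      obtain a b where ab: "a \<in> C x" "u \<in> B a" "b \<in> C x" "v \<in> B b" using uv by blast
      then have "(a, b) \<in> (quotient_rel E B V \<inter> C x \<times> C x)\<^sup>*"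
        using conn unfolding connected_rel_def by blast
      then show ?thesis using path ab by blast
    qed
    ultimately show "connected_rel E ?U" unfolding connected_rel_def by blast
  qed
qed

lemma clustering_restrict:
  "\<lbrakk>clustering E W B V M; S \<subseteq> V; S \<noteq> {}\<rbrakk> \<Longrightarrow> clustering E W B S M"
  unfolding clustering_def using disjoint_family_on_mono[of S V B] by (auto intro: finite_subset)

lemma quotient_rel_compose:
  "quotient_rel (quotient_rel E B V) C V' \<subseteq> quotient_rel E (\<lambda>x. \<Union>c\<in>C x. B c) V'"
proof
  fix p assume "p \<in> quotient_rel (quotient_rel E B V) C V'"
  then obtain x y c c' u v where p: "p = (x, y)" "x \<in> V'" "y \<in> V'" "x \<noteq> y"
      "c \<in> C x" "c' \<in> C y" "u \<in> B c" "v \<in> B c'" "(u, v) \<in> E"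
    unfolding quotient_rel_def by auto
  then have "u \<in> (\<Union>c\<in>C x. B c)" "v \<in> (\<Union>c\<in>C y. B c)" by auto
  then show "p \<in> quotient_rel E (\<lambda>x. \<Union>c\<in>C x. B c) V'"
    unfolding quotient_rel_def using p by blast
qed

text \<open>A set \<open>S\<close> of branch sets pulls back to at most \<open>M * card S\<close>
  vertices, and distinct pairs of branch sets have distinct witnessing edges. Hence \<open>M\<close>
  divides the size bound and multiplies the sparseness bound.\<close>

lemma sparse_upto_quotient:
  fixes E :: "('v \<times> 'v) set" and V :: "'w set"
  assumes "finite E" "sparse_upto E N \<delta>" and B: "clustering E W B V M" and "0 < M" "0 \<le> \<delta>"
  shows "sparse_upto (quotient_rel E B V) (N / M) (M * \<delta>)"
  unfolding sparse_upto_def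
proof (intro allI impI)
  fix S :: "'w set" assume S: "finite S \<and> real (card S) \<le> N / M"
  have Bd: "disjoint_family_on B V"
    and Bx: "\<And>c. c \<in> V \<Longrightarrow> finite (B c) \<and> card (B c) \<le> M"
    using B unfolding clustering_def by auto
  let ?S = "S \<inter> V"
  define U where "U = (\<Union>c\<in>?S. B c)"
  have finS: "finite ?S" using S by simp
  have finU: "finite U" unfolding U_def using finS Bx by auto
  have "real (card U) \<le> (\<Sum>c\<in>?S. real (card (B c)))"
    unfolding U_def using card_UN_le[OF finS, of B] by (metis of_nat_le_iff of_nat_sum)
  also have "\<dots> \<le> (\<Sum>c\<in>?S. M)" using Bx by (intro sum_mono) auto
  also have "\<dots> \<le> M * card S" using S assms(4) by (simp add: card_mono)
  finally have cU: "real (card U) \<le> M * card S" .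
  also have "\<dots> \<le> N" using S assms(4) by (simp add: field_simps)
  finally have "card (E \<inter> U \<times> U) \<le> \<delta> * card U"
    using assms(2) finU unfolding sparse_upto_def by blast
  also have "\<dots> \<le> \<delta> * (M * card S)" using cU assms(5) by (intro mult_left_mono) auto
  finally have up: "card (E \<inter> U \<times> U) \<le> \<delta> * (M * card S)" .
  let ?Q = "quotient_rel E B V \<inter> S \<times> S"
  have "\<forall>p\<in>?Q. \<exists>e. e \<in> E \<inter> U \<times> U \<and> fst e \<in> B (fst p) \<and> snd e \<in> B (snd p)"
  proof
    fix p assume "p \<in> ?Q"
    then obtain x y u v where p: "p = (x, y)" "x \<in> ?S" "y \<in> ?S" "u \<in> B x" "v \<in> B y" "(u, v) \<in> E"
      unfolding quotient_rel_def by blast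
    then have "(u, v) \<in> E \<inter> U \<times> U" unfolding U_def by blast
    then show "\<exists>e. e \<in> E \<inter> U \<times> U \<and> fst e \<in> B (fst p) \<and> snd e \<in> B (snd p)"
      using p by (intro exI[of _ "(u, v)"]) simp
  qed
  then obtain h where h: "\<forall>p\<in>?Q. h p \<in> E \<inter> U \<times> U \<and> fst (h p) \<in> B (fst p) \<and> snd (h p) \<in> B (snd p)"
    by (rule bchoice[THEN exE])
  have "inj_on h ?Q"
  proof (rule inj_onI)
    fix p q assume pq: "p \<in> ?Q" "q \<in> ?Q" "h p = h q"
    have "fst (h p) \<in> B (fst p) \<inter> B (fst q)" "snd (h p) \<in> B (snd p) \<inter> B (snd q)"
      using bspec[OF h pq(1)] bspec[OF h pq(2)] pq(3) by auto
    moreover have "fst p \<in> V" "snd p \<in> V" "fst q \<in> V" "snd q \<in> V"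
      using pq unfolding quotient_rel_def by auto
    ultimately have "fst p = fst q" "snd p = snd q"
      using Bd unfolding disjoint_family_on_def by blast+
    then show "p = q" by (rule prod_eqI)
  qed
  moreover have "h ` ?Q \<subseteq> E \<inter> U \<times> U" using h by blast
  ultimately have "card ?Q \<le> card (E \<inter> U \<times> U)"
    using assms(1) by (intro card_inj_on_le) auto
  then show "card ?Q \<le> M * \<delta> * card S" using up by (simp add: mult_ac)
qed

section \<open>Constant losses as exponent losses, and the iteration\<close>

text \<open>In a round \<open>b * K\<close> bounds the growth of the branch sets and
  \<open>b * K / c\<close> is the gain in density; the loss \<open>c\<close> is absorbed by
  \<open>K powr \<epsilon>\<close>.\<close>

lemma powr_le_if_exponent_loss:
  fixes b c K \<epsilon> :: real
  assumes "0 < \<epsilon>" "\<epsilon> < 1" "1 \<le> b" "0 < c" "0 < K" "c \<le> K powr \<epsilon>"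
  shows "(b * K) powr (1 - \<epsilon>) \<le> b * K / c"
proof -
  have "(b * K) powr (1 - \<epsilon>) = b powr (1 - \<epsilon>) * K powr (1 - \<epsilon>)"
    using assms by (simp add: powr_mult)
  also have "\<dots> \<le> b * K powr (1 - \<epsilon>)"
    using assms powr_mono[of "1 - \<epsilon>" 1 b] by (intro mult_right_mono) auto
  also have "K powr (1 - \<epsilon>) = K / K powr \<epsilon>" using assms by (simp add: powr_diff)
  also have "b * (K / K powr \<epsilon>) \<le> b * (K / c)"
    using assms by (intro mult_left_mono divide_left_mono) auto
  finally show ?thesis by simp
qed

lemma ex_nat_powr_ge:
  fixes c \<epsilon> :: real
  assumes "0 < \<epsilon>"
  shows "\<exists>K :: nat. 1 \<le> K \<and> c \<le> real K powr \<epsilon>"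
proof -
  obtain K :: nat where K: "max 1 (max 1 c powr (1 / \<epsilon>)) \<le> K" using real_arch_simple by blast
  have "c \<le> max 1 c" by simp
  also have "\<dots> = (max 1 c powr (1 / \<epsilon>)) powr \<epsilon>" using assms by (simp add: powr_powr)
  also have "\<dots> \<le> K powr \<epsilon>" using K assms by (intro powr_mono2) auto
  finally show ?thesis using K by (intro exI[of _ K]) auto
qed

text \<open>\<open>D\<close> is the target and \<open>T\<close> the branch set size at which it is
  reached, by the last inequality. The condition on \<open>\<rho>\<close> keeps the local bound
  \<open>M * \<delta>\<close> far below the current average degree as long as \<open>M < T\<close>;
  the condition on \<open>N\<close> keeps neighbourhoods, of size about \<open>D\<close>, within
  \<open>N / M\<close>.\<close>

lemma dense_quotient:
  fixes \<epsilon> :: real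
  assumes \<epsilon>: "0 < \<epsilon>" "\<epsilon> < 1"
  shows "\<exists>Q\<ge>1. \<forall>(V :: 'v set) E (\<rho> :: real) \<delta> N (D :: real) T.
    finite V \<and> V \<noteq> {} \<and> E \<subseteq> V \<times> V \<and> sym E \<and> irrefl E \<and> sparse_upto E N \<delta> \<and> 1 \<le> \<delta> \<and>
    \<rho> * card V \<le> card E \<and> 1 \<le> T \<and> 0 \<le> D \<and>
    Q * \<delta> * T powr \<epsilon> \<le> \<rho> \<and> Q * D * T \<le> N \<and> D \<le> \<rho> * T powr (1 - \<epsilon>) \<longrightarrow>
    (\<exists>C (V' :: 'v set) g. clustering E V C V' g \<and> D * card V' \<le> card (quotient_rel E C V'))"
proof -
  obtain K1 :: nat where K1: "1 \<le> K1" "512 \<le> K1 powr \<epsilon>" using ex_nat_powr_ge[OF \<epsilon>(1), of 512] by auto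
  define \<Lambda> where "\<Lambda> = 16 * (K1 + 2)"
  define \<Gamma> where "\<Gamma> = 4 * \<Lambda>"
  \<comment> \<open>Branch sets grow by at most \<open>50 * \<Gamma> ^ 3 * K2\<close> and the
    density by \<open>K2 / (1024 * \<Gamma>)\<close>; the quotient of the two is this constant.
    Likewise 512 compares \<open>2 * K1\<close> with \<open>K1 / 256\<close>.\<close>
  obtain K2 :: nat where K2: "1 \<le> K2" "51200 * real \<Gamma> ^ 4 \<le> K2 powr \<epsilon>"
    using ex_nat_powr_ge[OF \<epsilon>(1), of "51200 * real \<Gamma> ^ 4"] by auto
  define L where "L = 16 * \<Gamma> ^ 3 * (K2 + 2)"
  define g1 where "g1 = real (K1 + 1)"
  define g2 where "g2 = real (L + 1 + K2)"
  have \<Gamma>1: "1 \<le> real \<Gamma>" unfolding \<Gamma>_def \<Lambda>_def by simp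
  have g12: "2 \<le> g1" "2 \<le> g2" unfolding g1_def g2_def using K1 K2 by auto
  have gain1: "g1 powr (1 - \<epsilon>) \<le> K1 / 256"
  proof -
    have "g1 powr (1 - \<epsilon>) \<le> (2 * real K1) powr (1 - \<epsilon>)"
      using K1 \<epsilon> unfolding g1_def by (intro powr_mono2) auto
    also have "\<dots> \<le> 2 * real K1 / 512" using K1 \<epsilon> by (intro powr_le_if_exponent_loss) auto
    finally show ?thesis by simp
  qed
  have gain2: "g2 powr (1 - \<epsilon>) \<le> K2 / (1024 * \<Gamma>)"
  proof -
    have K2r: "1 \<le> real K2" using K2 by simp
    have \<Gamma>3: "1 \<le> real \<Gamma> ^ 3" using \<Gamma>1 by simp
    have "1 * real K2 \<le> real \<Gamma> ^ 3 * real K2" using \<Gamma>3 by (intro mult_right_mono) auto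
    moreover have "real \<Gamma> ^ 3 * 1 \<le> real \<Gamma> ^ 3 * real K2" using K2r by (intro mult_left_mono) auto
    moreover have "g2 = 16 * (real \<Gamma> ^ 3 * real K2) + 32 * real \<Gamma> ^ 3 + 1 + real K2"
      unfolding g2_def L_def by (simp add: algebra_simps)
    ultimately have "g2 \<le> 50 * real \<Gamma> ^ 3 * real K2" using K2r by linarith
    then have "g2 powr (1 - \<epsilon>) \<le> (50 * real \<Gamma> ^ 3 * real K2) powr (1 - \<epsilon>)"
      using g12 \<epsilon> by (intro powr_mono2) auto
    also have "\<dots> \<le> 50 * real \<Gamma> ^ 3 * real K2 / (51200 * real \<Gamma> ^ 4)"
    proof (rule powr_le_if_exponent_loss)
      show "1 \<le> 50 * real \<Gamma> ^ 3" using \<Gamma>3 by linarith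
    qed (use K2 \<epsilon> \<Gamma>1 in auto)
    also have "\<dots> = K2 / (1024 * \<Gamma>)" using \<Gamma>1 by (simp add: field_simps power3_eq_cube power4_eq_xxxx)
    finally show ?thesis .
  qed
  define c1 where "c1 = 65536 * real K2 * real \<Gamma> ^ 3 * (real L + 1)"
  define c2 where "c2 = 160 * real \<Gamma> ^ 2 * real L ^ 2"
  define c3 where "c3 = 16384 * real K1 * \<Lambda>"
  define c4 where "c4 = 3 * real \<Lambda>"
  define c5 where "c5 = \<Gamma> * (real L + 1)"
  define Q where "Q = c1 + c2 + c3 + c4 + c5 + 1"
  have c0: "0 \<le> c1" "0 \<le> c2" "0 \<le> c3" "0 \<le> c4" "0 \<le> c5"
    unfolding c1_def c2_def c3_def c4_def c5_def by auto
  have Q1: "1 \<le> Q" using c0 unfolding Q_def by linarith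
  have cQ: "c1 \<le> Q" "c2 \<le> Q" "c3 \<le> Q" "c4 \<le> Q" "c5 \<le> Q" using c0 unfolding Q_def by linarith+
  show ?thesis
  proof (intro exI[of _ Q] conjI allI impI)
    show "1 \<le> Q" by (rule Q1)
    fix V :: "'v set" and E and \<rho> \<delta> N D T :: real
    assume asm: "finite V \<and> V \<noteq> {} \<and> E \<subseteq> V \<times> V \<and> sym E \<and> irrefl E \<and> sparse_upto E N \<delta> \<and> 1 \<le> \<delta> \<and>
      \<rho> * card V \<le> card E \<and> 1 \<le> T \<and> 0 \<le> D \<and>
      Q * \<delta> * T powr \<epsilon> \<le> \<rho> \<and> Q * D * T \<le> N \<and> D \<le> \<rho> * T powr (1 - \<epsilon>)"
    then have V: "finite V" "V \<noteq> {}" and E: "E \<subseteq> V \<times> V" "sym E" "irrefl E" "sparse_upto E N \<delta>"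
      and \<delta>: "1 \<le> \<delta>" and dense: "\<rho> * card V \<le> card E" and T: "1 \<le> T" and D: "0 \<le> D"
      and p1: "Q * \<delta> * T powr \<epsilon> \<le> \<rho>" and p2: "Q * D * T \<le> N" and p3: "D \<le> \<rho> * T powr (1 - \<epsilon>)"
      by simp_all
    have finE: "finite E" using E V by (meson finite_SigmaI finite_subset)
    have "0 \<le> Q * \<delta> * T powr \<epsilon>" using Q1 \<delta> by simp
    then have \<rho>0: "0 \<le> \<rho>" using p1 by linarith
    show "\<exists>C (V' :: 'v set) g. clustering E V C V' g \<and> D * card V' \<le> card (quotient_rel E C V')"
    proof (rule ccontr)
      assume neg: "\<not> ?thesis"
      have sparse: "card (quotient_rel E C V') < D * card V'"
        if "clustering E V C V' g" for C g and V' :: "'v set"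
      proof -
        have "\<not> D * card V' \<le> card (quotient_rel E C V')" using neg that by blast
        then show ?thesis by simp
      qed
      \<comment> \<open>The invariant of the iteration: reaching branch set size \<open>M\<close>
        has cost at most a factor \<open>M powr \<epsilon>\<close> against the ideal
        \<open>\<rho> * M\<close>.\<close>
      define good where "good M \<longleftrightarrow> 1 \<le> M \<and> (\<exists>C (V' :: 'v set). clustering E V C V' M \<and>
        \<rho> * M powr (1 - \<epsilon>) * card V' \<le> card (quotient_rel E C V'))" for M :: real
      have "good 1"
      proof -
        have "clustering E V (\<lambda>x. {x}) V 1"
          using V unfolding clustering_def disjoint_family_on_def by (auto simp: connected_rel_singleton)
        moreover have "quotient_rel E (\<lambda>x. {x}) V = E"
          using E unfolding quotient_rel_def irrefl_def by auto
        ultimately show ?thesis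
          unfolding good_def using dense by (intro conjI exI[of _ "\<lambda>x. {x}"] exI[of _ V]) auto
      qed
      have step: "\<exists>M'. good M' \<and> 2 * M \<le> M'" if gM: "good M" and MT: "M < T" for M
      proof -
        from gM obtain B and V1 :: "'v set" where M: "1 \<le> M" and B: "clustering E V B V1 M"
          and B2: "\<rho> * M powr (1 - \<epsilon>) * card V1 \<le> card (quotient_rel E B V1)"
          unfolding good_def by blast
        have V1: "finite V1" "V1 \<noteq> {}" using B unfolding clustering_def by auto
        have c\<rho>: "c * (M * \<delta>) \<le> \<rho> * M powr (1 - \<epsilon>)" if "c \<le> Q" for c
        proof -
          have "c * (M * \<delta>) \<le> Q * (M * \<delta>)" using that M \<delta> by (intro mult_right_mono) auto
          also have "\<dots> = Q * \<delta> * (M powr \<epsilon> * M powr (1 - \<epsilon>))"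
            using M by (simp flip: powr_add)
          also have "\<dots> = (Q * \<delta> * M powr \<epsilon>) * M powr (1 - \<epsilon>)" by simp
          also have "\<dots> \<le> (Q * \<delta> * T powr \<epsilon>) * M powr (1 - \<epsilon>)"
            using M MT \<epsilon> Q1 \<delta> by (intro mult_right_mono mult_left_mono powr_mono2) auto
          also have "\<dots> \<le> \<rho> * M powr (1 - \<epsilon>)" using p1 by (intro mult_right_mono) auto
          finally show ?thesis .
        qed
        have cN: "c * D \<le> N / M" if "c \<le> Q" for c
        proof -
          have "c * D * M \<le> Q * D * M" using that M D by (intro mult_right_mono) auto
          also have "\<dots> \<le> Q * D * T" using MT Q1 D by (intro mult_left_mono) auto
          finally show ?thesis using p2 M by (simp add: field_simps)
        qed
        let ?R = "quotient_rel E B V1"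
        have "\<exists>C (V' :: 'v set).
          clustering ?R V1 C V' (K1 + 1) \<and>
            K1 * (\<rho> * M powr (1 - \<epsilon>)) / 256 * card V' \<le> card (quotient_rel ?R C V') \<or>
          clustering ?R V1 C V' (L + 1 + K2) \<and>
            K2 * (\<rho> * M powr (1 - \<epsilon>)) / (1024 * \<Gamma>) * card V' \<le> card (quotient_rel ?R C V')"
        proof (rule contraction_step[OF V1])
          show "?R \<subseteq> V1 \<times> V1" "irrefl ?R" unfolding quotient_rel_def irrefl_def by auto
          show "sym ?R" by (rule sym_quotient_rel[OF E(2)])
          show "sparse_upto ?R (N / M) (M * \<delta>)"
            using sparse_upto_quotient[OF finE E(4) B] M \<delta> by simp
          show "\<rho> * M powr (1 - \<epsilon>) * card V1 \<le> card ?R" by (rule B2)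
          \<comment> \<open>The branch sets indexed by \<open>S\<close> alone form another quotient
            of the original graph, so the assumption refuted at the end bounds its density
            meanwhile.\<close>
          show "card (?R \<inter> S \<times> S) \<le> D * card S" if S: "S \<subseteq> V1" for S
          proof (cases "S = {}")
            case False
            have "clustering E V B S M"
              by (rule clustering_restrict[OF B S False])
            moreover have "?R \<inter> S \<times> S = quotient_rel E B S" using S unfolding quotient_rel_def by auto
            ultimately show ?thesis using sparse[of B S M] by simp
          qed simp
          show "1 \<le> M * \<delta>" using M \<delta> mult_mono[of 1 M 1 \<delta>] by simp
          show "65536 * real K2 * \<Gamma> ^ 3 * (L + 1) * (M * \<delta>) \<le> \<rho> * M powr (1 - \<epsilon>)"
            using c\<rho>[OF cQ(1)] unfolding c1_def by (simp add: algebra_simps)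
          show "160 * real \<Gamma> ^ 2 * L\<^sup>2 * (M * \<delta>) \<le> \<rho> * M powr (1 - \<epsilon>)"
            using c\<rho>[OF cQ(2)] unfolding c2_def by simp
          show "16384 * real K1 * \<Lambda> * (M * \<delta>) \<le> \<rho> * M powr (1 - \<epsilon>)"
            using c\<rho>[OF cQ(3)] unfolding c3_def by simp
          show "3 * \<Lambda> * D \<le> N / M" using cN[OF cQ(4)] unfolding c4_def by simp
          show "\<Gamma> * D * (L + 1) \<le> N / M" using cN[OF cQ(5)] unfolding c5_def by (simp add: algebra_simps)
        qed (use K1 K2 \<Lambda>_def \<Gamma>_def L_def in auto)
        then have "\<exists>g C (V' :: 'v set). 2 \<le> g \<and> clustering ?R V1 C V' g \<and>
          (\<rho> * M powr (1 - \<epsilon>)) * g powr (1 - \<epsilon>) * card V' \<le> card (quotient_rel ?R C V')"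
        proof (elim exE disjE conjE)
          fix C and V' :: "'v set"
          assume C: "clustering ?R V1 C V' (K1 + 1)"
            "K1 * (\<rho> * M powr (1 - \<epsilon>)) / 256 * card V' \<le> card (quotient_rel ?R C V')"
          have "(\<rho> * M powr (1 - \<epsilon>)) * g1 powr (1 - \<epsilon>) * card V'
              \<le> (\<rho> * M powr (1 - \<epsilon>)) * (K1 / 256) * card V'"
            using gain1 \<rho>0 by (intro mult_right_mono mult_left_mono) auto
          also have "\<dots> = K1 * (\<rho> * M powr (1 - \<epsilon>)) / 256 * card V'" by simp
          also note C(2)
          finally show ?thesis
            using C(1) g12(1) unfolding g1_def by (intro exI[of _ "real (K1 + 1)"] exI[of _ C] exI[of _ V'] conjI)
        next
          fix C and V' :: "'v set"
          assume C: "clustering ?R V1 C V' (L + 1 + K2)"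
            "K2 * (\<rho> * M powr (1 - \<epsilon>)) / (1024 * \<Gamma>) * card V' \<le> card (quotient_rel ?R C V')"
          have "(\<rho> * M powr (1 - \<epsilon>)) * g2 powr (1 - \<epsilon>) * card V'
              \<le> (\<rho> * M powr (1 - \<epsilon>)) * (K2 / (1024 * \<Gamma>)) * card V'"
            using gain2 \<rho>0 by (intro mult_right_mono mult_left_mono) auto
          also have "\<dots> = K2 * (\<rho> * M powr (1 - \<epsilon>)) / (1024 * \<Gamma>) * card V'" by simp
          also note C(2)
          finally show ?thesis
            using C(1) g12(2) unfolding g2_def by (intro exI[of _ "real (L + 1 + K2)"] exI[of _ C] exI[of _ V'] conjI)
        qed
        then obtain g C and V' :: "'v set" where g: "2 \<le> g" and C: "clustering ?R V1 C V' g"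
          and C2: "(\<rho> * M powr (1 - \<epsilon>)) * g powr (1 - \<epsilon>) * card V' \<le> card (quotient_rel ?R C V')"
          by (elim exE conjE)
        let ?C = "\<lambda>x. \<Union>c\<in>C x. B c"
        have clus: "clustering E V ?C V' (M * g)" using clustering_compose[OF B C] M by simp
        have finV': "finite V'" using C unfolding clustering_def by blast
        have "\<rho> * (M * g) powr (1 - \<epsilon>) * card V' = (\<rho> * M powr (1 - \<epsilon>)) * g powr (1 - \<epsilon>) * card V'"
          using M g by (simp add: powr_mult)
        also have "\<dots> \<le> card (quotient_rel ?R C V')" by (rule C2)
        also have "\<dots> \<le> card (quotient_rel E ?C V')"
          using card_mono[OF finite_quotient_rel[OF finV'] quotient_rel_compose] by (simp only: of_nat_le_iff)
        finally have "good (M * g)"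
          using clus M g mult_mono[of 1 M 1 g] unfolding good_def by auto
        moreover have "2 * M \<le> M * g" using g M by simp
        ultimately show ?thesis by blast
      qed
      \<comment> \<open>Each step at least doubles \<open>M\<close>, so \<open>T\<close> is passed;
        overshooting it only raises the density.\<close>
      have "\<exists>M. good M \<and> (T \<le> M \<or> 2 ^ k \<le> M)" for k :: nat
      proof (induction k)
        case 0
        then show ?case using \<open>good 1\<close> by auto
      next
        case (Suc k)
        then obtain M where M: "good M" "T \<le> M \<or> 2 ^ k \<le> M" by blast
        show ?case
        proof (cases "T \<le> M")
          case False
          then obtain M' where "good M'" "2 * M \<le> M'" using step[OF M(1)] by auto
          then show ?thesis using M(2) False by (intro exI[of _ M']) auto
        qed (use M in blast)
      qed
      moreover obtain k :: nat where "T < 2 ^ k" using real_arch_pow[of 2 T] by auto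
      ultimately obtain M where "good M" and "T \<le> M \<or> 2 ^ k \<le> M" by blast
      then have TM: "T \<le> M" using \<open>T < 2 ^ k\<close> by linarith
      from \<open>good M\<close> obtain C and V' :: "'v set" where C: "clustering E V C V' M"
        and C2: "\<rho> * M powr (1 - \<epsilon>) * card V' \<le> card (quotient_rel E C V')"
        unfolding good_def by blast
      have "D \<le> \<rho> * T powr (1 - \<epsilon>)" by (rule p3)
      also have "\<dots> \<le> \<rho> * M powr (1 - \<epsilon>)"
        using \<rho>0 T TM \<epsilon> by (intro mult_left_mono powr_mono2) auto
      finally have "D * card V' \<le> \<rho> * M powr (1 - \<epsilon>) * card V'" by (intro mult_right_mono) auto
      then show False using C2 sparse[OF C] by linarith
    qed
  qed
qed

section \<open>Graphs and the Turan exponent\<close>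

definition edge_rel :: "'a ugraph \<Rightarrow> ('a \<times> 'a) set" where
  "edge_rel G = {(u, v). {u, v} \<in> edges G}"

lemma edge_rel_simple:
  assumes "simple_graph G"
  shows "edge_rel G \<subseteq> verts G \<times> verts G" "sym (edge_rel G)" "irrefl (edge_rel G)"
proof -
  have e: "u \<in> verts G \<and> v \<in> verts G \<and> u \<noteq> v" if uv: "{u, v} \<in> edges G" for u v
  proof -
    obtain a b where "{u, v} = {a, b}" "a \<in> verts G" "b \<in> verts G" "a \<noteq> b"
      using assms uv unfolding simple_graph_def by blast
    then show ?thesis by (auto simp: doubleton_eq_iff)
  qed
  show "edge_rel G \<subseteq> verts G \<times> verts G" "irrefl (edge_rel G)"
    using e unfolding edge_rel_def irrefl_def by blast+
  show "sym (edge_rel G)" unfolding edge_rel_def sym_def by (simp add: insert_commute)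
qed

lemma finite_edges: "simple_graph G \<Longrightarrow> finite (edges G)"
  unfolding simple_graph_def by (rule finite_subset[of _ "Pow (verts G)"]) auto

lemma card_edge_rel:
  assumes "simple_graph G"
  shows "card (edge_rel G) = 2 * card (edges G)"
proof -
  have "edge_rel G = (\<Union>e\<in>edges G. {(u, v). {u, v} = e})" unfolding edge_rel_def by auto
  moreover have two: "finite {(u, v). {u, v} = e} \<and> card {(u, v). {u, v} = e} = 2" if e_in: "e \<in> edges G" for e
  proof -
    obtain a b where e: "e = {a, b}" "a \<noteq> b" using assms e_in unfolding simple_graph_def by blast
    have "{(u, v). {u, v} = e} = {(a, b), (b, a)}" using e by (auto simp: doubleton_eq_iff)
    then show ?thesis using e by simp
  qed
  moreover have "card (\<Union>e\<in>edges G. {(u, v). {u, v} = e}) = (\<Sum>e\<in>edges G. card {(u, v). {u, v} = e})"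
    using finite_edges[OF assms] two by (intro card_UN_disjoint) auto
  ultimately show ?thesis by simp
qed

definition graph_of_rel :: "'a set \<Rightarrow> ('a \<times> 'a) set \<Rightarrow> 'a ugraph" where
  "graph_of_rel V R = \<lparr>verts = V, edges = {{x, y} | x y. (x, y) \<in> R}\<rparr>"

lemma graph_of_rel_simple:
  assumes "finite V" "R \<subseteq> V \<times> V" "irrefl R"
  shows "simple_graph (graph_of_rel V R)"
  unfolding simple_graph_def graph_of_rel_def
proof (intro conjI subsetI, goal_cases)
  case (2 e)
  then obtain x y where "e = {x, y}" "(x, y) \<in> R" by auto
  moreover from this have "x \<in> V" "y \<in> V" "x \<noteq> y" using assms unfolding irrefl_def by auto
  ultimately show ?case by auto
qed (use assms in simp)

lemma edge_rel_graph_of_rel: "sym R \<Longrightarrow> edge_rel (graph_of_rel V R) = R"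
  unfolding edge_rel_def graph_of_rel_def sym_def by (auto simp: doubleton_eq_iff)

text \<open>The factor 2 in the hypothesis is there because \<open>quotient_rel\<close> counts
  ordered pairs while \<open>graph_density\<close> counts edges.\<close>

lemma minor_of_clustering:
  fixes V :: "'w set" and D :: real
  assumes G: "simple_graph G" and C: "clustering (edge_rel G) (verts G) C V g"
    and dense: "2 * D * card V \<le> card (quotient_rel (edge_rel G) C V)"
  shows "\<exists>J :: 'w ugraph. simple_graph J \<and> is_minor J G \<and> D \<le> graph_density J"
proof -
  let ?R = "quotient_rel (edge_rel G) C V"
  let ?J = "graph_of_rel V ?R"
  have V: "finite V" "V \<noteq> {}" and Cx: "\<And>x. x \<in> V \<Longrightarrow> C x \<subseteq> verts G \<and> connected_rel (edge_rel G) (C x)"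
    and Cd: "disjoint_family_on C V"
    using C unfolding clustering_def by auto
  have R: "?R \<subseteq> V \<times> V" "irrefl ?R" "sym ?R"
    using sym_quotient_rel[OF edge_rel_simple(2)[OF G]] unfolding quotient_rel_def irrefl_def by auto
  have J: "simple_graph ?J" by (rule graph_of_rel_simple[OF V(1) R(1,2)])
  have vJ: "verts ?J = V" unfolding graph_of_rel_def by simp
  have "is_minor ?J G"
    unfolding is_minor_def
  proof (intro exI[of _ C] conjI ballI allI impI)
    fix x assume "x \<in> verts ?J"
    then have x: "C x \<subseteq> verts G" "connected_rel (edge_rel G) (C x)" using Cx vJ by auto
    have "{(a, b). a \<in> C x \<and> b \<in> C x \<and> {a, b} \<in> edges G} = edge_rel G \<inter> C x \<times> C x"
      unfolding edge_rel_def by auto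
    then show "connected_in G (C x)" using x unfolding connected_in_def connected_rel_def by simp
  next
    show "disjoint_family_on C (verts ?J)" using Cd vJ by simp
  next
    fix x y assume "{x, y} \<in> edges ?J"
    then have "(x, y) \<in> edge_rel ?J" unfolding edge_rel_def by simp
    then have "(x, y) \<in> ?R" using edge_rel_graph_of_rel[OF R(3)] by simp
    then show "\<exists>u\<in>C x. \<exists>v\<in>C y. {u, v} \<in> edges G" unfolding quotient_rel_def edge_rel_def by auto
  qed
  moreover have "D \<le> graph_density ?J"
  proof -
    have "card ?R = 2 * card (edges ?J)"
      using card_edge_rel[OF J] edge_rel_graph_of_rel[OF R(3)] by simp
    then have "D * card V \<le> card (edges ?J)" using dense by simp
    moreover have "0 < real (card V)" using V by (simp add: card_gt_0_iff)
    ultimately show ?thesis unfolding graph_density_def vJ by (simp add: le_divide_eq)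
  qed
  ultimately show ?thesis using J by blast
qed

section \<open>Freeness, Turan numbers and the local sparseness they give\<close>

lemma is_minor_refl:
  assumes "simple_graph G"
  shows "is_minor G G"
proof -
  have "connected_in G {x}" if "x \<in> verts G" for x using that unfolding connected_in_def by simp
  then show ?thesis
    unfolding is_minor_def disjoint_family_on_def by (intro exI[of _ "\<lambda>x. {x}"]) auto
qed

text \<open>A forbidden copy in \<open>G'\<close> is carried into \<open>G\<close> by
  \<open>\<theta>\<close>. It serves both for subgraphs and for relabelled graphs.\<close>

lemma graph_free_if_embeds:
  fixes H :: "'h ugraph" and G :: "'b ugraph" and G' :: "'c ugraph"
  assumes free: "graph_free H G" and "inj_on \<theta> (verts G')" "\<theta> ` verts G' \<subseteq> verts G"
    and edges: "\<And>e. e \<in> edges G' \<Longrightarrow> \<theta> ` e \<in> edges G"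
  shows "graph_free H G'"
  unfolding graph_free_def
proof
  assume "\<exists>K. subgraph K G' \<and> isomorphic K H"
  then obtain K where K: "subgraph K G'" "isomorphic K H" by blast
  have sK: "simple_graph K" "verts K \<subseteq> verts G'" "edges K \<subseteq> edges G'"
    using K unfolding subgraph_def by auto
  have inj: "inj_on \<theta> (verts K)" using assms(2) sK inj_on_subset by blast
  define K' where "K' = \<lparr>verts = \<theta> ` verts K, edges = (\<lambda>e. \<theta> ` e) ` edges K\<rparr>"
  have ed: "{\<theta> a, \<theta> b} \<in> edges K' \<longleftrightarrow> {a, b} \<in> edges K" if ab: "a \<in> verts K" "b \<in> verts K" for a b
  proof
    assume "{\<theta> a, \<theta> b} \<in> edges K'"
    then obtain e where e: "e \<in> edges K" "\<theta> ` {a, b} = \<theta> ` e" unfolding K'_def by auto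
    have "e \<subseteq> verts K" using sK(1) e(1) unfolding simple_graph_def by blast
    then have "{a, b} = e" using inj_on_image_eq_iff[OF inj, of "{a, b}" e] ab e(2) by simp
    then show "{a, b} \<in> edges K" using e by simp
  next
    assume "{a, b} \<in> edges K"
    then show "{\<theta> a, \<theta> b} \<in> edges K'" unfolding K'_def by (auto intro: image_eqI[of _ _ "{a, b}"])
  qed
  have "simple_graph K'"
    unfolding simple_graph_def
  proof (intro conjI subsetI)
    show "finite (verts K')" using sK(1) unfolding K'_def simple_graph_def by simp
    fix e assume "e \<in> edges K'"
    then obtain e0 where e0: "e0 \<in> edges K" "e = \<theta> ` e0" unfolding K'_def by auto
    then obtain a b where ab: "e0 = {a, b}" "a \<in> verts K" "b \<in> verts K" "a \<noteq> b"
      using sK(1) unfolding simple_graph_def by blast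
    then have "e = {\<theta> a, \<theta> b}" "\<theta> a \<noteq> \<theta> b" using e0 inj by (auto dest: inj_onD)
    then show "e \<in> {{u, v} | u v. u \<in> verts K' \<and> v \<in> verts K' \<and> u \<noteq> v}"
      using ab unfolding K'_def by auto
  qed
  moreover have "verts K' \<subseteq> verts G" "edges K' \<subseteq> edges G"
    using sK assms(3) edges unfolding K'_def by auto
  ultimately have sub: "subgraph K' G" unfolding subgraph_def by blast
  obtain \<phi> where \<phi>: "bij_betw \<phi> (verts K) (verts H)"
    "\<forall>u\<in>verts K. \<forall>v\<in>verts K. {u, v} \<in> edges K \<longleftrightarrow> {\<phi> u, \<phi> v} \<in> edges H"
    using K(2) unfolding isomorphic_def by blast
  let ?i = "inv_into (verts K) \<theta>"
  have "bij_betw ?i (verts K') (verts K)"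
    unfolding K'_def using inj by (simp add: bij_betw_inv_into inj_on_imp_bij_betw)
  then have "bij_betw (\<phi> \<circ> ?i) (verts K') (verts H)" using \<phi>(1) by (rule bij_betw_trans)
  moreover have "{u, v} \<in> edges K' \<longleftrightarrow> {(\<phi> \<circ> ?i) u, (\<phi> \<circ> ?i) v} \<in> edges H"
    if uv: "u \<in> verts K'" "v \<in> verts K'" for u v
  proof -
    obtain a b where ab: "u = \<theta> a" "v = \<theta> b" "a \<in> verts K" "b \<in> verts K"
      using uv unfolding K'_def by auto
    then have "?i u = a" "?i v = b" using inj by auto
    then show ?thesis using ed[of a b] \<phi>(2) ab by simp
  qed
  ultimately have "isomorphic K' H" unfolding isomorphic_def by blast
  then show False using free sub unfolding graph_free_def by blast
qed

text \<open>\<open>turan_number\<close> ranges over graphs on natural numbers, so \<open>G\<close>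
  is relabelled; freeness survives because the inverse relabelling embeds the copy back.\<close>

lemma card_edges_le_turan_number:
  fixes H :: "'h ugraph" and G :: "'b ugraph"
  assumes G: "simple_graph G" "graph_free H G"
  shows "card (edges G) \<le> turan_number (card (verts G)) H"
proof -
  have finV: "finite (verts G)" using G unfolding simple_graph_def by simp
  obtain \<phi> :: "'b \<Rightarrow> nat" where \<phi>: "inj_on \<phi> (verts G)"
    using finite_imp_inj_to_nat_seg[OF finV] by blast
  define G' where "G' = \<lparr>verts = \<phi> ` verts G, edges = (\<lambda>e. \<phi> ` e) ` edges G\<rparr>"
  have sub: "e \<subseteq> verts G" if "e \<in> edges G" for e using G(1) that unfolding simple_graph_def by blast
  let ?i = "inv_into (verts G) \<phi>"
  have "simple_graph G'"
    unfolding simple_graph_def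
  proof (intro conjI subsetI)
    show "finite (verts G')" using finV unfolding G'_def by simp
    fix e assume "e \<in> edges G'"
    then obtain e0 where e0: "e0 \<in> edges G" "e = \<phi> ` e0" unfolding G'_def by auto
    then obtain a b where ab: "e0 = {a, b}" "a \<in> verts G" "b \<in> verts G" "a \<noteq> b"
      using G(1) unfolding simple_graph_def by blast
    then have "e = {\<phi> a, \<phi> b}" "\<phi> a \<noteq> \<phi> b" using e0 \<phi> by (auto dest: inj_onD)
    then show "e \<in> {{u, v} | u v. u \<in> verts G' \<and> v \<in> verts G' \<and> u \<noteq> v}"
      using ab unfolding G'_def by auto
  qed
  moreover have "card (verts G') = card (verts G)" unfolding G'_def using \<phi> by (simp add: card_image)
  moreover have cE: "card (edges G') = card (edges G)"
  proof -
    have "inj_on (\<lambda>e. \<phi> ` e) (edges G)"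
    proof (rule inj_onI)
      fix e e' assume e: "e \<in> edges G" "e' \<in> edges G" "\<phi> ` e = \<phi> ` e'"
      then show "e = e'" using inj_on_image_eq_iff[OF \<phi> sub[OF e(1)] sub[OF e(2)]] by simp
    qed
    then show ?thesis unfolding G'_def by (simp add: card_image)
  qed
  moreover have "graph_free H G'"
  proof (rule graph_free_if_embeds[OF G(2), of ?i])
    show "inj_on ?i (verts G')" unfolding G'_def by (simp add: inj_on_inv_into)
    show "?i ` verts G' \<subseteq> verts G" unfolding G'_def by (auto simp: \<phi>)
    fix e assume "e \<in> edges G'"
    then obtain e0 where e0: "e0 \<in> edges G" "e = \<phi> ` e0" unfolding G'_def by auto
    have "?i ` e = e0" unfolding e0(2) using \<phi> sub[OF e0(1)] by (rule inv_into_image_cancel)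
    then show "?i ` e \<in> edges G" using e0 by simp
  qed
  ultimately have "card (edges G') \<in> {card (edges F) | F :: nat ugraph.
      simple_graph F \<and> card (verts F) = card (verts G) \<and> graph_free H F}"
    by - (rule CollectI, rule exI[of _ G'], intro conjI refl; assumption)
  \<comment> \<open>A supremum of naturals dominates the members only of a bounded set; counting all
    vertex subsets is bound enough.\<close>
  moreover have "bdd_above {card (edges F) | F :: nat ugraph.
      simple_graph F \<and> card (verts F) = card (verts G) \<and> graph_free H F}"
  proof (rule bdd_aboveI[of _ "2 ^ card (verts G)"])
    fix n assume "n \<in> {card (edges F) | F :: nat ugraph.
      simple_graph F \<and> card (verts F) = card (verts G) \<and> graph_free H F}"
    then obtain F :: "nat ugraph" where F: "n = card (edges F)" "simple_graph F"
      "card (verts F) = card (verts G)" by blast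
    have "edges F \<subseteq> Pow (verts F)" using F(2) unfolding simple_graph_def by blast
    moreover have "finite (verts F)" using F(2) unfolding simple_graph_def by simp
    ultimately have "card (edges F) \<le> card (Pow (verts F))" by (intro card_mono) auto
    then show "n \<le> 2 ^ card (verts G)" using F \<open>finite (verts F)\<close> by (simp add: card_Pow)
  qed
  ultimately have "card (edges G') \<le> turan_number (card (verts G)) H"
    unfolding turan_number_def by (rule cSup_upper)
  then show ?thesis using cE by simp
qed

lemma eventually_turan_number_le:
  assumes "1 < turan_exponent H" "0 < \<eta>"
  shows "\<exists>n0\<ge>1. \<forall>n\<ge>n0. turan_number n H \<le> real n powr (turan_exponent H + \<eta>)"
proof -
  let ?q = "\<lambda>n. ereal (ln (real (turan_number n H)) / ln (real n))"
  \<comment> \<open>\<open>real_of_ereal\<close> sends both infinities to 0, so a value above 1 can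
    only come from a finite limit superior.\<close>
  have "\<bar>limsup ?q\<bar> \<noteq> \<infinity>"
    using assms(1) unfolding turan_exponent_def by auto
  then have "limsup ?q = ereal (turan_exponent H)"
    unfolding turan_exponent_def by (simp add: ereal_real)
  then have "limsup ?q < ereal (turan_exponent H + \<eta>)" using assms(2) by simp
  then have "eventually (\<lambda>n. ?q n < ereal (turan_exponent H + \<eta>)) sequentially"
    by (rule Limsup_lessD)
  then obtain n1 where n1: "\<And>n. n \<ge> n1 \<Longrightarrow> ?q n < ereal (turan_exponent H + \<eta>)"
    unfolding eventually_sequentially by blast
  \<comment> \<open>From 2 on \<open>ln n\<close> is positive, which allows multiplying by
    it.\<close>
  have "turan_number n H \<le> real n powr (turan_exponent H + \<eta>)" if n: "n \<ge> max n1 2" for n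
  proof (cases "turan_number n H = 0")
    case False
    have ln: "0 < ln (real n)" using n by simp
    have "ln (real (turan_number n H)) / ln (real n) < turan_exponent H + \<eta>" using n1[of n] n by simp
    then have "ln (real (turan_number n H)) < (turan_exponent H + \<eta>) * ln (real n)"
      using ln by (simp add: divide_less_eq)
    then have "exp (ln (real (turan_number n H))) \<le> exp ((turan_exponent H + \<eta>) * ln (real n))" by simp
    then show ?thesis using False n by (simp add: powr_def)
  qed simp
  then show ?thesis by (intro exI[of _ "max n1 2"]) auto
qed

text \<open>A set of size k \<ge> \<open>n0\<close> spans at most k^p = k^(p-1) k edges, and k \<le>
  \<open>N\<close>. Smaller sets satisfy the trivial bound k^2 with k < \<open>n0\<close> \<le>
  \<open>\<delta>\<close>. The factor 2 turns edges into ordered pairs.\<close>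

lemma sparse_upto_if_graph_free:
  fixes H :: "'h ugraph" and G :: "'b ugraph"
  assumes G: "simple_graph G" "graph_free H G" and "1 < p"
    and n0: "\<And>n. n \<ge> n0 \<Longrightarrow> turan_number n H \<le> real n powr p"
    and \<delta>: "real n0 \<le> \<delta>" "N powr (p - 1) \<le> \<delta>"
  shows "sparse_upto (edge_rel G) N (2 * \<delta>)"
  unfolding sparse_upto_def
proof (intro allI impI)
  fix S0 :: "'b set" assume S0: "finite S0 \<and> real (card S0) \<le> N"
  define S where "S = S0 \<inter> verts G"
  let ?R = "edge_rel G \<inter> S \<times> S"
  let ?F = "graph_of_rel S ?R"
  have finS: "finite S" using S0 unfolding S_def by simp
  have cS: "card S \<le> card S0" unfolding S_def using S0 by (intro card_mono) auto
  have eq: "edge_rel G \<inter> S0 \<times> S0 = ?R" using edge_rel_simple(1)[OF G(1)] unfolding S_def by auto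
  have symR: "sym ?R" using edge_rel_simple(2)[OF G(1)] unfolding sym_def by blast
  have irrR: "irrefl ?R" using edge_rel_simple(3)[OF G(1)] unfolding irrefl_def by blast
  have F: "simple_graph ?F" by (rule graph_of_rel_simple[OF finS _ irrR]) auto
  have vF: "verts ?F = S" unfolding graph_of_rel_def by simp
  have cR: "card ?R = 2 * card (edges ?F)"
    using card_edge_rel[OF F] edge_rel_graph_of_rel[OF symR] by simp
  have \<delta>0: "0 \<le> \<delta>" using \<delta>(1) by linarith
  have "card ?R \<le> 2 * \<delta> * card S"
  proof (cases "card S < n0")
    case True
    have "card ?R \<le> card (S \<times> S)" using finS by (intro card_mono) auto
    then have "real (card ?R) \<le> real (card S) * card S" by (simp add: card_cartesian_product flip: of_nat_mult)
    also have "\<dots> \<le> (2 * \<delta>) * card S" using True \<delta> \<delta>0 by (intro mult_right_mono) auto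
    finally show ?thesis .
  next
    case False
    have "graph_free H ?F"
    proof (rule graph_free_if_embeds[OF G(2), of "\<lambda>x. x"])
      show "(\<lambda>x. x) ` verts ?F \<subseteq> verts G" unfolding vF unfolding S_def by auto
      show "(\<lambda>x. x) ` e \<in> edges G" if "e \<in> edges ?F" for e
        using that unfolding graph_of_rel_def edge_rel_def by auto
    qed simp
    then have "card (edges ?F) \<le> turan_number (card S) H"
      using card_edges_le_turan_number[OF F] vF by simp
    then have "real (card (edges ?F)) \<le> real (card S) powr p" using n0[of "card S"] False by simp
    also have "\<dots> \<le> \<delta> * card S"
    proof (cases "card S = 0")
      case False
      then have pos: "0 < real (card S)" by simp
      have "real (card S) powr p = real (card S) powr (p - 1) * real (card S)"
        using pos powr_add[of "real (card S)" "p - 1" 1] by simp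
      also have "\<dots> \<le> N powr (p - 1) * real (card S)"
        using cS S0 assms(3) by (intro mult_right_mono powr_mono2) auto
      also have "\<dots> \<le> \<delta> * real (card S)" using \<delta>(2) by (intro mult_right_mono) auto
      finally show ?thesis .
    qed simp
    finally show ?thesis using cR by simp
  qed
  also have "\<dots> \<le> 2 * \<delta> * card S0" using cS \<delta>0 by (intro mult_left_mono) auto
  finally show "card (edge_rel G \<inter> S0 \<times> S0) \<le> 2 * \<delta> * card S0" unfolding eq .
qed

section \<open>Choice of exponents and the error term\<close>

lemma eventually_powr_ge:
  fixes a c :: real
  assumes "0 < a"
  shows "eventually (\<lambda>x. c \<le> x powr a) at_top"
proof -
  obtain K :: nat where K: "c \<le> real K powr a" using ex_nat_powr_ge[OF assms] by blast
  have "c \<le> x powr a" if "real K \<le> x" for x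
  proof -
    have "real K powr a \<le> x powr a" using that assms by (intro powr_mono2) auto
    then show ?thesis using K by linarith
  qed
  then show ?thesis unfolding eventually_at_top_linorder by blast
qed

lemma dense_minor_if_graph_free:
  fixes H :: "'a ugraph" and \<theta> :: real
  defines "\<gamma> \<equiv> turan_exponent H"
  defines "\<kappa> \<equiv> \<gamma> / (2 * (\<gamma> - 1))"
  assumes \<gamma>: "1 < \<gamma>" and \<theta>: "0 < \<theta>"
  shows "eventually (\<lambda>d. \<forall>G :: 'b ugraph. simple_graph G \<and> graph_free H G \<and> graph_density G = d \<longrightarrow>
    (\<exists>J :: 'b ugraph. simple_graph J \<and> is_minor J G \<and> d powr (\<kappa> - \<theta>) \<le> graph_density J)) at_top"
\<comment> \<open>When no gain is asked, \<open>G\<close> is its own witness. The other case makes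
  \<open>\<tau>\<close> and \<open>\<nu>\<close> positive.\<close>
proof (cases "\<kappa> - \<theta> \<le> 1")
  case True
  show ?thesis
    using eventually_ge_at_top[of 1]
  proof eventually_elim
    case (elim d)
    have "d powr (\<kappa> - \<theta>) \<le> d" using powr_mono[OF True elim] elim by simp
    then show ?case using is_minor_refl by blast
  qed
next
  case False
  \<comment> \<open>\<open>dense_quotient\<close> is used with \<open>T = d powr \<tau>\<close>,
    \<open>N = d powr \<nu>\<close>, \<open>\<rho> = 2 * d\<close> and
    \<open>D = 2 * d powr (\<kappa> - \<theta>)\<close>. Without losses the exponents would be
    \<open>\<kappa> - 1\<close> and \<open>2 * \<kappa> - 1 = 1 / (\<gamma> - 1)\<close>; each gives
    up \<open>\<theta> / 2\<close>.\<close>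
  define \<tau> where "\<tau> = \<kappa> - 1 - \<theta> / 2"
  define \<nu> where "\<nu> = 2 * \<kappa> - 1 - \<theta> / 2"
  \<comment> \<open>The loss in \<open>\<nu>\<close> makes \<open>\<nu> * (\<gamma> - 1)\<close>
    equal to \<open>1 - 2 * s\<close>. One \<open>s\<close> pays for replacing
    \<open>\<gamma>\<close> by \<open>p\<close>, since \<open>\<nu> * \<eta> = s\<close>; the other
    separates the local bound \<open>2 * d powr (1 - s)\<close> from \<open>2 * d\<close> and is
    shared equally by \<open>Q\<close> and \<open>T powr \<epsilon>\<close>.\<close>
  define s where "s = \<theta> * (\<gamma> - 1) / 4"
  define \<eta> where "\<eta> = s / \<nu>"
  define p where "p = \<gamma> + \<eta>"
  \<comment> \<open>The last two terms bound \<open>\<tau> * \<epsilon>\<close> by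
    \<open>\<theta> / 2\<close>, to reach \<open>D\<close>, and by \<open>s / 2\<close>, to stay
    above the local bound.\<close>
  define \<epsilon> where "\<epsilon> = min (1 / 2) (min (\<theta> / (2 * \<tau>)) (s / (2 * \<tau>)))"
  have \<kappa>\<tau>: "\<kappa> = 1 + \<tau> + \<theta> / 2" unfolding \<tau>_def by simp
  have \<tau>: "0 < \<tau>" using False \<theta> unfolding \<tau>_def by linarith
  have \<nu>: "0 < \<nu>" using False \<theta> unfolding \<nu>_def by linarith
  have s: "0 < s" unfolding s_def using \<gamma> \<theta> by simp
  have \<eta>: "0 < \<eta>" unfolding \<eta>_def using s \<nu> by simp
  have \<epsilon>: "0 < \<epsilon>" "\<epsilon> < 1" unfolding \<epsilon>_def using \<tau> s \<theta> by auto
  have \<tau>\<epsilon>: "\<tau> * \<epsilon> \<le> \<theta> / 2" "\<tau> * \<epsilon> \<le> s / 2"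
  proof -
    have "\<epsilon> \<le> \<theta> / (2 * \<tau>)" "\<epsilon> \<le> s / (2 * \<tau>)" unfolding \<epsilon>_def by auto
    then have "\<tau> * \<epsilon> \<le> \<tau> * (\<theta> / (2 * \<tau>))" "\<tau> * \<epsilon> \<le> \<tau> * (s / (2 * \<tau>))"
      using \<tau> by (auto simp only: mult_le_cancel_left_pos)
    then show "\<tau> * \<epsilon> \<le> \<theta> / 2" "\<tau> * \<epsilon> \<le> s / 2" using \<tau> by simp_all
  qed
  have "(2 * \<kappa> - 1) * (\<gamma> - 1) = 1" unfolding \<kappa>_def using \<gamma> by (simp add: field_simps)
  then have \<nu>\<gamma>: "\<nu> * (\<gamma> - 1) = 1 - 2 * s" unfolding \<nu>_def s_def by (simp add: field_simps)
  then have \<nu>p: "\<nu> * (p - 1) = 1 - s"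
    unfolding p_def \<eta>_def using \<nu> by (simp add: algebra_simps)
  have "0 < \<nu> * (\<gamma> - 1)" using \<nu> \<gamma> by simp
  then have s1: "0 < 1 - s" using \<nu>\<gamma> s by linarith
  obtain n0 :: nat where n0: "\<forall>n\<ge>n0. turan_number n H \<le> real n powr p"
    using eventually_turan_number_le[of H \<eta>] \<gamma> \<eta> unfolding p_def \<gamma>_def by blast
  from dense_quotient[OF \<epsilon>, where 'v = 'b]
  obtain Q where Q: "1 \<le> Q" and dq: "\<forall>(V :: 'b set) E (\<rho> :: real) \<delta> N (D :: real) T.
    finite V \<and> V \<noteq> {} \<and> E \<subseteq> V \<times> V \<and> sym E \<and> irrefl E \<and> sparse_upto E N \<delta> \<and> 1 \<le> \<delta> \<and>
    \<rho> * card V \<le> card E \<and> 1 \<le> T \<and> 0 \<le> D \<and>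
    Q * \<delta> * T powr \<epsilon> \<le> \<rho> \<and> Q * D * T \<le> N \<and> D \<le> \<rho> * T powr (1 - \<epsilon>) \<longrightarrow>
    (\<exists>C (V' :: 'b set) g. clustering E V C V' g \<and> D * card V' \<le> card (quotient_rel E C V'))"
    by (elim exE conjE)
  show ?thesis
    using eventually_ge_at_top[of 1] eventually_powr_ge[OF \<theta>, of "2 * Q"]
      eventually_powr_ge[of "s / 2" Q, simplified, OF s] eventually_powr_ge[OF s1, of "real n0"]
  proof eventually_elim
    case (elim d)
    show ?case
    proof (intro allI impI, elim conjE)
      fix G :: "'b ugraph"
      assume G: "simple_graph G" "graph_free H G" and d: "graph_density G = d"
      let ?E = "edge_rel G" and ?\<delta> = "2 * d powr (1 - s)" and ?D = "2 * d powr (\<kappa> - \<theta>)"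
      have d0: "0 < d" using elim by simp
      have finV: "finite (verts G)" using G(1) unfolding simple_graph_def by simp
      have Vne: "verts G \<noteq> {}" using d d0 unfolding graph_density_def by auto
      then have cV: "0 < real (card (verts G))" using finV by (simp add: card_gt_0_iff)
      have "sparse_upto ?E (d powr \<nu>) ?\<delta>"
      proof (rule sparse_upto_if_graph_free[OF G _ n0[rule_format]])
        show "1 < p" unfolding p_def using \<gamma> \<eta> by simp
        show "real n0 \<le> d powr (1 - s)" by (rule elim)
        show "(d powr \<nu>) powr (p - 1) \<le> d powr (1 - s)" by (simp add: powr_powr \<nu>p)
      qed
      moreover have "1 \<le> ?\<delta>" using ge_one_powr_ge_zero[of d "1 - s"] elim s1 by simp
      moreover have "(2 * d) * card (verts G) \<le> card ?E"
        using card_edge_rel[OF G(1)] cV unfolding d[symmetric] graph_density_def by simp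
      moreover have "1 \<le> d powr \<tau>" using ge_one_powr_ge_zero[of d \<tau>] elim \<tau> by simp
      moreover have "Q * ?\<delta> * (d powr \<tau>) powr \<epsilon> \<le> 2 * d"
      proof -
        have "Q * ?\<delta> * (d powr \<tau>) powr \<epsilon> \<le> d powr (s / 2) * ?\<delta> * d powr (s / 2)"
          unfolding powr_powr using elim Q \<tau>\<epsilon>(2) by (intro mult_mono powr_mono) auto
        also have "\<dots> = 2 * d powr (s / 2 + (1 - s) + s / 2)" by (simp only: powr_add mult_ac)
        also have "\<dots> = 2 * d" using d0 by simp
        finally show ?thesis .
      qed
      moreover have "Q * ?D * d powr \<tau> \<le> d powr \<nu>"
      proof -
        have "Q * ?D * d powr \<tau> = (2 * Q) * (d powr (\<kappa> - \<theta>) * d powr \<tau>)" by simp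
        also have "\<dots> \<le> d powr \<theta> * (d powr (\<kappa> - \<theta>) * d powr \<tau>)"
          using elim by (intro mult_right_mono) auto
        also have "\<dots> = d powr (\<theta> + ((\<kappa> - \<theta>) + \<tau>))" by (simp only: powr_add)
        also have "\<theta> + ((\<kappa> - \<theta>) + \<tau>) = \<nu>" unfolding \<tau>_def \<nu>_def by simp
        finally show ?thesis .
      qed
      moreover have "?D \<le> (2 * d) * (d powr \<tau>) powr (1 - \<epsilon>)"
      proof -
        have "\<kappa> - \<theta> \<le> 1 + \<tau> * (1 - \<epsilon>)" using \<tau>\<epsilon>(1) \<kappa>\<tau> by (simp add: algebra_simps)
        then have "d powr (\<kappa> - \<theta>) \<le> d powr (1 + \<tau> * (1 - \<epsilon>))" using elim by (intro powr_mono) auto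
        also have "\<dots> = d * (d powr \<tau>) powr (1 - \<epsilon>)" using d0 by (simp add: powr_add powr_powr)
        finally show ?thesis by simp
      qed
      moreover have "0 \<le> ?D" by simp
      ultimately have "\<exists>C (V' :: 'b set) g. clustering ?E (verts G) C V' g \<and>
          ?D * card V' \<le> card (quotient_rel ?E C V')"
        using finV Vne edge_rel_simple[OF G(1)]
        by (intro dq[rule_format, of "verts G" ?E "d powr \<nu>" ?\<delta> "2 * d" "d powr \<tau>" ?D] conjI)
      then obtain C and V' :: "'b set" and g where C: "clustering ?E (verts G) C V' g"
        "2 * d powr (\<kappa> - \<theta>) * card V' \<le> card (quotient_rel ?E C V')" by blast
      show "\<exists>J :: 'b ugraph. simple_graph J \<and> is_minor J G \<and> d powr (\<kappa> - \<theta>) \<le> graph_density J"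
        by (rule minor_of_clustering[OF G(1) C])
    qed
  qed
qed

text \<open>\<open>dense_minor_if_graph_free\<close> allows every fixed loss once the density is
  large. The infimum of the admissible losses at each density merges these statements into one error
  function.\<close>

theorem theorem5p3:
  fixes H :: "'a ugraph"
  assumes "simple_graph H"
    and "bipartite H"
    and "turan_exponent H > 1"
  shows "\<exists>\<epsilon> :: real \<Rightarrow> real. (\<epsilon> \<longlongrightarrow> 0) at_top \<and>
    (\<forall>G :: 'b ugraph. simple_graph G \<and> graph_free H G \<longrightarrow>
      (\<exists>J :: 'b ugraph. simple_graph J \<and> is_minor J G \<and>
        graph_density J \<ge>
          graph_density G powr
            (turan_exponent H / (2 * (turan_exponent H - 1)) - \<epsilon> (graph_density G))))"
proof -
  define \<kappa> where "\<kappa> = turan_exponent H / (2 * (turan_exponent H - 1))"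
  define claim where "claim d \<theta> \<longleftrightarrow> (\<forall>G :: 'b ugraph.
    simple_graph G \<and> graph_free H G \<and> graph_density G = d \<longrightarrow>
    (\<exists>J :: 'b ugraph. simple_graph J \<and> is_minor J G \<and> d powr (\<kappa> - \<theta>) \<le> graph_density J))" for d \<theta>
  define losses where "losses d = {\<theta>. 0 \<le> \<theta> \<and> claim d \<theta>}" for d
  \<comment> \<open>The infimum need not be attained, hence the vanishing \<open>1 / d\<close>.
    Below density 1 the exponent becomes exactly 1, and \<open>G\<close> itself serves.\<close>
  define \<epsilon> where "\<epsilon> d = (if 1 \<le> d then Inf (losses d) + 1 / d else \<kappa> - 1)" for d :: real
  have trivial: "claim d \<theta>" if "d powr (\<kappa> - \<theta>) \<le> d" for d \<theta>
    unfolding claim_def using that is_minor_refl by blast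
  have bdd: "bdd_below (losses d)" for d unfolding losses_def by (rule bdd_belowI[of _ 0]) auto
  have ne: "losses d \<noteq> {}" if "1 \<le> d" for d
  proof -
    \<comment> \<open>This loss is nonnegative and lowers the exponent to at most 1, so
      \<open>G\<close> itself shows it admissible.\<close>
    have "d powr (\<kappa> - max 0 (\<kappa> - 1)) \<le> d powr 1" using that by (intro powr_mono) auto
    then have "max 0 (\<kappa> - 1) \<in> losses d" unfolding losses_def using trivial that by simp
    then show ?thesis by blast
  qed
  have claim_\<epsilon>: "claim d (\<epsilon> d)" if d: "0 \<le> d" for d
  proof (cases "1 \<le> d")
    case True
    then have "Inf (losses d) < \<epsilon> d" unfolding \<epsilon>_def by simp
    then obtain \<theta> where \<theta>: "\<theta> \<in> losses d" "\<theta> < \<epsilon> d"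
      using cInf_less_iff[OF ne[OF True] bdd] by blast
    have le: "d powr (\<kappa> - \<epsilon> d) \<le> d powr (\<kappa> - \<theta>)" using \<theta> True by (intro powr_mono) auto
    show ?thesis
      unfolding claim_def
    proof (intro allI impI)
      fix G :: "'b ugraph" assume "simple_graph G \<and> graph_free H G \<and> graph_density G = d"
      then obtain J :: "'b ugraph" where "simple_graph J" "is_minor J G" "d powr (\<kappa> - \<theta>) \<le> graph_density J"
        using \<theta>(1) unfolding losses_def claim_def by blast
      then show "\<exists>J :: 'b ugraph. simple_graph J \<and> is_minor J G \<and> d powr (\<kappa> - \<epsilon> d) \<le> graph_density J"
        using le by (intro exI[of _ J]) auto
    qed
  next
    case False
    then show ?thesis using d by (intro trivial) (simp add: \<epsilon>_def)
  qed
  have "(\<epsilon> \<longlongrightarrow> 0) at_top"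
  proof (rule tendstoI)
    fix e :: real assume e: "0 < e"
    then have e2: "0 < e / 2" by simp
    have "eventually (\<lambda>d. claim d (e / 2)) at_top"
      using dense_minor_if_graph_free[OF assms(3) e2, where 'b = 'b] unfolding claim_def \<kappa>_def .
    then show "eventually (\<lambda>d. dist (\<epsilon> d) 0 < e) at_top"
      using eventually_ge_at_top[of 1] eventually_gt_at_top[of "2 / e"]
    proof eventually_elim
      case (elim d)
      have "e / 2 \<in> losses d" using elim e unfolding losses_def by simp
      then have up: "Inf (losses d) \<le> e / 2" using bdd by (rule cInf_lower)
      have low: "0 \<le> Inf (losses d)" using ne[OF elim(2)] by (rule cInf_greatest) (simp add: losses_def)
      have "1 / d < e / 2" using elim e by (simp add: field_simps)
      then show ?case using up low elim unfolding \<epsilon>_def dist_real_def by simp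
    qed
  qed
  moreover have "\<exists>J :: 'b ugraph. simple_graph J \<and> is_minor J G \<and>
      graph_density J \<ge> graph_density G powr (\<kappa> - \<epsilon> (graph_density G))"
    if G: "simple_graph G" "graph_free H G" for G :: "'b ugraph"
  proof -
    have "0 \<le> graph_density G" unfolding graph_density_def by simp
    then show ?thesis using claim_\<epsilon> G unfolding claim_def by blast
  qed
  ultimately show ?thesis unfolding \<kappa>_def by blast
qed

end
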